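(* Let $S$ be a nonempty set and fix $s_\bullet\in S$. The subspace of primitive elements of the coalgebra $(\mathbb K[\mathbf{PBT}^S],\overset{\circledast}{\Delta})$ (i.e. elements $x$ of positive degree with $\overset{\circledast}{\Delta}(x)=1_{\mathbb K}\otimes x+x\otimes1_{\mathbb K}$) equals $\mathbb K[\mathcal I^S]:=\bigoplus_{n\ge1}\mathbb K[\mathcal I^S_n]$. Moreover, the coalgebra $(\mathbb K[\mathbf{PBT}^S],\overset{\circledast}{\Delta})$ is isomorphic to the cotensor coalgebra $T^c(\mathbb K[\mathcal I^S])$ (the tensor space with deconcatenation coproduct).
   Context: Planar binary rooted trees: every internal vertex has two children; $\mathbf{PBT}_n$ = such trees with $n$ leaves ($n-1$ internal vertices), $\mathbf{PBT}_1=\{\vert\}$. Internal vertices of a tree are ordered left to right (in-order: the vertex between leaves $i$ and $i+1$ is the $i$-th). $\mathbf{PBT}^S_n$ is the set of pairs $(t,(s_1,\dots,s_{n-1}))$ with $t\in\mathbf{PBT}_n$ and $s_i\in S$ the color of the $i$-th internal vertex; $\mathbb K[\mathbf{PBT}^S]=\mathbb K1_{\mathbb K}\oplus\bigoplus_{n\ge1}\mathbb K[\mathbf{PBT}^S_n]$. For $x_i=\sum_s a^i_s s\in\mathbb K[S]$, $(t,(x_1,\dots,x_{n-1}))$ denotes the multilinear expansion $\sum a^1_{s_1}\cdots a^{n-1}_{s_{n-1}}(t,(s_1,\dots,s_{n-1}))$. For $s\in S$: $(t,(s_1..s_{n-1}))\veebar_s(w,(r_1..r_{m-1}))=(t\veebar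 w,(s_1,\dots,s_{n-1},s,r_1,\dots,r_{m-1}))$, where $t\veebar w$ joins the roots of $t$ (left) and $w$ (right) to a new root. Grafting: $(t,(s_1..s_{n-1}))\circ_j(w,(r_1..r_{m-1}))=(t\circ_j w,(s_1,\dots,s_{j-1},r_1,\dots,r_{m-1},s_j,\dots,s_{n-1}))$, $t\circ_j w$ identifying the root of $w$ with the $j$-th leaf of $t$; and $x\,\underline{\circ}\,(w_1,\dots,w_r)=(((x\circ_r w_r)\circ_{r-1}w_{r-1})\cdots)\circ_1 w_1$ for $x$ with $r$ leaves; all extended multilinearly. Coproduct: $\overset{\circledast}{\Delta}(1_{\mathbb K})=1_{\mathbb K}\otimes1_{\mathbb K}$, $\overset{\circledast}{\Delta}(\vert)=1_{\mathbb K}\otimes\vert+\vert\otimes1_{\mathbb K}$, $\overset{\circledast}{\Delta}(T\veebar_s W)=\sum T_{(1)}\otimes(T_{(2)}\veebar_s W)+\sum(T\veebar_s W_{(1)})\otimes W_{(2)}-T\otimes W$ with $1_{\mathbb K}\veebar_s W=W$, $T\veebar_s1_{\mathbb K}=T$. Tamari order $\le_T$ on $\mathbf{PBT}_n$: generated by $(t_1\veebar t_2)\veebar t_3\le_T t_1\veebar(t_2\veebar t_3)$ and compatibility of $\veebar$ with $\le_T$ in each argument; $M_t=\sum_{w\le_T t}\mu(w,t)w$ ($\mu$ its Möbius function), and $(M_t,(s_1,\dots,s_{n-1})):=\sum_{w\le_T t}\mu(w,t)(w,(s_1,\dots,s_{n-1}))$. Product $\rightthreetimes$ on uncolored trees: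 $t\rightthreetimes w=w\circ_1(t\veebar\vert)$; $t$ is $\rightthreetimes$-irreducible if it is not $u\rightthreetimes w$ for trees $u,w$. For $s\ne s_\bullet$, $\hat s:=s-s_\bullet\in\mathbb K[S]$. Define $\mathcal I^S_1=\{\vert\}$; $\mathcal I^S_2=\{(\vert\veebar\vert,(\hat s)) : s\in S\setminus\{s_\bullet\}\}$; for $n>2$, $\mathcal I^S_n$ is the union of $\{(M_t,(s_1,\dots,s_{n-1})): t\in\mathbf{PBT}_n\ \rightthreetimes\text{-irreducible},\ s_i\in S\}$ and $\{x\,\underline{\circ}\,(w_1,\dots,w_r): x\in\mathcal I^S_r,\ w_j\in\mathcal I^S_{m_j},\ r,m_j<n,\ \sum_j m_j=n\}$; $\mathbb K[\mathcal I^S_n]$ is its span. *)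

theory Defs
  imports Complex_Main "HOL-Library.Poly_Mapping" "HOL-Library.Tree"
begin

section \<open>Free vector spaces\<close>

text \<open>
  The free vector space over a field \<open>'k\<close> on a basis \<open>'b\<close> is \<^typ>\<open>'b \<Rightarrow>\<^sub>0 'k\<close>. The tensor product of
  the free spaces on \<open>'a\<close> and \<open>'b\<close> is the free space on \<open>'a \<times> 'b\<close>.
\<close>

definition pscale :: "'k::field \<Rightarrow> ('b \<Rightarrow>\<^sub>0 'k) \<Rightarrow> ('b \<Rightarrow>\<^sub>0 'k)" where
  "pscale c x = Poly_Mapping.map ((*) c) x"

lemma lookup_pscale [simp]: "Poly_Mapping.lookup (pscale c x) b = c * Poly_Mapping.lookup x b"
  by (cases "Poly_Mapping.lookup x b = 0") (simp_all add: pscale_def Poly_Mapping.map.rep_eq)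

interpretation pvs: vector_space "pscale :: 'k::field \<Rightarrow> ('b \<Rightarrow>\<^sub>0 'k) \<Rightarrow> ('b \<Rightarrow>\<^sub>0 'k)"
  by unfold_locales (auto intro!: poly_mapping_eqI simp: lookup_add algebra_simps)

abbreviation basis :: "'b \<Rightarrow> ('b \<Rightarrow>\<^sub>0 'k::field)" where
  "basis b \<equiv> Poly_Mapping.single b 1"

definition lin_ext :: "('a \<Rightarrow> ('b \<Rightarrow>\<^sub>0 'k)) \<Rightarrow> ('a \<Rightarrow>\<^sub>0 'k::field) \<Rightarrow> ('b \<Rightarrow>\<^sub>0 'k)" where
  "lin_ext f x = (\<Sum>a\<in>Poly_Mapping.keys x. pscale (Poly_Mapping.lookup x a) (f a))"

definition bilin_ext ::
  "('a \<Rightarrow> 'b \<Rightarrow> ('c \<Rightarrow>\<^sub>0 'k)) \<Rightarrow> ('a \<Rightarrow>\<^sub>0 'k::field) \<Rightarrow> ('b \<Rightarrow>\<^sub>0 'k) \<Rightarrow> ('c \<Rightarrow>\<^sub>0 'k)" where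
  "bilin_ext f x y = lin_ext (\<lambda>a. lin_ext (f a) y) x"

definition tensor :: "('a \<Rightarrow>\<^sub>0 'k::field) \<Rightarrow> ('b \<Rightarrow>\<^sub>0 'k) \<Rightarrow> ('a \<times> 'b \<Rightarrow>\<^sub>0 'k)" where
  "tensor = bilin_ext (\<lambda>a b. basis (a, b))"

text \<open>\<open>tensor_map f g\<close> is \<open>f \<otimes> g\<close>, for linear \<open>f\<close> and \<open>g\<close>.\<close>

definition tensor_map ::
  "(('a \<Rightarrow>\<^sub>0 'k) \<Rightarrow> ('c \<Rightarrow>\<^sub>0 'k)) \<Rightarrow> (('b \<Rightarrow>\<^sub>0 'k) \<Rightarrow> ('d \<Rightarrow>\<^sub>0 'k))
    \<Rightarrow> ('a \<times> 'b \<Rightarrow>\<^sub>0 'k::field) \<Rightarrow> ('c \<times> 'd \<Rightarrow>\<^sub>0 'k)" where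
  "tensor_map f g = lin_ext (\<lambda>(a, b). tensor (f (basis a)) (g (basis b)))"


section \<open>Planar binary rooted trees\<close>

text \<open>
  An uncolored tree is a \<^typ>\<open>unit tree\<close>; a colored tree \<open>(t, (s\<^sub>1, \<dots>, s\<^sub>n\<^sub>-\<^sub>1))\<close> is the \<^typ>\<open>'s tree\<close>
  whose shape is \<open>t\<close> and whose in-order list of labels is \<open>[s\<^sub>1, \<dots>, s\<^sub>n\<^sub>-\<^sub>1]\<close> (\<open>colored\<close> below). With
  this encoding \<open>Node t s w\<close> is the colored join of \<open>t\<close> and \<open>w\<close> along \<open>s\<close>. The number of leaves is
  \<^const>\<open>size1\<close>.
\<close>

type_synonym pbt = "unit tree"

fun colored :: "pbt \<Rightarrow> 's list \<Rightarrow> 's tree" where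
  "colored Leaf cs = Leaf"
| "colored (Node l u r) cs =
     Node (colored l (take (size l) cs)) (cs ! size l) (colored r (drop (Suc (size l)) cs))"

lemma map_tree_colored: "map_tree (\<lambda>_. ()) (colored t cs) = t"
  by (induction t arbitrary: cs) auto

lemma inorder_colored: "length cs = size t \<Longrightarrow> inorder (colored t cs) = cs"
  by (induction t arbitrary: cs) (auto simp: id_take_nth_drop[symmetric])

text \<open>Grafting at the \<open>j\<close>-th leaf, the leaves being numbered from 1.\<close>

fun graft :: "'s tree \<Rightarrow> nat \<Rightarrow> 's tree \<Rightarrow> 's tree" where
  "graft Leaf j w = (if j = 1 then w else Leaf)"
| "graft (Node l s r) j w =
     (if j \<le> size1 l then Node (graft l j w) s r else Node l s (graft r (j - size1 l) w))"

lemma inorder_graft: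
  assumes "1 \<le> j" "j \<le> size1 t"
  shows "inorder (graft t j w) = take (j - 1) (inorder t) @ inorder w @ drop (j - 1) (inorder t)"
  using assms
proof (induction t arbitrary: j)
  case (Node l s r)
  show ?case
  proof (cases "j \<le> size1 l")
    case True
    then show ?thesis using Node by (simp add: size1_size)
  next
    case False
    then obtain i where i: "j = Suc (Suc (size l + i))"
      by (metis add_Suc less_iff_Suc_add not_le size1_size Suc_eq_plus1)
    then show ?thesis using Node False by (simp add: size1_size)
  qed
qed auto

text \<open>The product \<open>rightthreetimes\<close> of uncolored trees and its irreducible elements.\<close>

definition rprod :: "pbt \<Rightarrow> pbt \<Rightarrow> pbt" where
  "rprod t w = graft w 1 (Node t () Leaf)"

definition rirreducible :: "pbt \<Rightarrow> bool" where
  "rirreducible t \<longleftrightarrow> (\<nexists>u w. t = rprod u w)"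


subsection \<open>The Tamari order\<close>

inductive tamari_le :: "pbt \<Rightarrow> pbt \<Rightarrow> bool" where
  rot: "tamari_le (Node (Node t1 () t2) () t3) (Node t1 () (Node t2 () t3))"
| left: "tamari_le t t' \<Longrightarrow> tamari_le (Node t () w) (Node t' () w)"
| right: "tamari_le w w' \<Longrightarrow> tamari_le (Node t () w) (Node t () w')"
| refl: "tamari_le t t"
| trans: "tamari_le t u \<Longrightarrow> tamari_le u w \<Longrightarrow> tamari_le t w"

lemma tamari_size: "tamari_le t w \<Longrightarrow> size t = size w"
  by (induction rule: tamari_le.induct) auto

fun left_weight :: "pbt \<Rightarrow> nat" where
  "left_weight Leaf = 0"
| "left_weight (Node l u r) = size l + left_weight l + left_weight r"

lemma tamari_left_weight:
  "tamari_le t w \<Longrightarrow> left_weight w \<le> left_weight t \<and> (left_weight w = left_weight t \<longrightarrow> t = w)"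
proof (induction rule: tamari_le.induct)
  case (left t t' w)
  then show ?case using tamari_size[of t t'] by auto
qed auto

lemma tamari_antisym: "tamari_le t w \<Longrightarrow> tamari_le w t \<Longrightarrow> t = w"
  using tamari_left_weight[of t w] tamari_left_weight[of w t] by auto

lemma finite_pbt: "finite {t :: pbt. size t = n}"
proof (induction n rule: less_induct)
  case (less n)
  have "{t :: pbt. size t = n} \<subseteq>
      insert Leaf (\<Union>i<n. (\<lambda>(l, r). Node l () r) ` ({t. size t = i} \<times> {t. size t = n - 1 - i}))"
  proof
    fix t :: pbt
    assume "t \<in> {t. size t = n}"
    then show "t \<in> insert Leaf
        (\<Union>i<n. (\<lambda>(l, r). Node l () r) ` ({t. size t = i} \<times> {t. size t = n - 1 - i}))"
      by (cases t) (auto intro!: bexI[where x = "size (left t)"])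
  qed
  moreover have "finite (insert Leaf (\<Union>i<n. (\<lambda>(l, r). Node l () r) `
      ({t :: pbt. size t = i} \<times> {t :: pbt. size t = n - 1 - i})))"
    using less by auto
  ultimately show ?case by (rule finite_subset)
qed

lemma finite_tamari_below: "finite {w. tamari_le w t}"
  by (rule finite_subset[OF _ finite_pbt[of "size t"]]) (auto dest: tamari_size)

function tamari_mu :: "pbt \<Rightarrow> pbt \<Rightarrow> int" where
  "tamari_mu w t =
     (if w = t then 1
      else if tamari_le w t then - (\<Sum>u | tamari_le w u \<and> tamari_le u t \<and> u \<noteq> t. tamari_mu w u)
      else 0)"
  by pat_completeness auto
termination
proof (relation "measure (\<lambda>(w, t). left_weight w - left_weight t)", goal_cases)
  case (2 w t u)
  then have u: "tamari_le w u" "tamari_le u t" "u \<noteq> t" by auto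
  have "left_weight t < left_weight u"
    using tamari_left_weight[OF u(2)] u(3) by auto
  moreover have "left_weight u \<le> left_weight w"
    using tamari_left_weight[OF u(1)] by auto
  ultimately show ?case by auto
qed simp

declare tamari_mu.simps [simp del]


section \<open>The coalgebra of colored trees\<close>

text \<open>
  \<open>K[PBT\<^sup>S]\<close> is \<^typ>\<open>'s tree option \<Rightarrow>\<^sub>0 'k\<close>: \<^const>\<open>None\<close> is the basis element \<open>1\<^sub>K\<close> of degree 0 and
  \<open>Some t\<close> is the tree \<open>t\<close>, of degree \<open>size1 t\<close>. The positive degree part is also used in the form
  \<^typ>\<open>'s tree \<Rightarrow>\<^sub>0 'k\<close>, and \<open>incl\<close> is its inclusion.
\<close>

definition incl :: "('s tree \<Rightarrow>\<^sub>0 'k::field) \<Rightarrow> ('s tree option \<Rightarrow>\<^sub>0 'k)" where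
  "incl = lin_ext (\<lambda>t. basis (Some t))"

text \<open>
  The join along \<open>s\<close>, with the convention that \<open>1\<^sub>K\<close> is neutral. The join of \<open>1\<^sub>K\<close> with itself
  never occurs in the coproduct.
\<close>

fun join :: "'s \<Rightarrow> 's tree option \<Rightarrow> 's tree option \<Rightarrow> 's tree option" where
  "join s None w = w"
| "join s (Some t) None = Some t"
| "join s (Some t) (Some w) = Some (Node t s w)"

fun coprod_tree :: "'s tree \<Rightarrow> ('s tree option \<times> 's tree option \<Rightarrow>\<^sub>0 'k::field)" where
  "coprod_tree Leaf = basis (None, Some Leaf) + basis (Some Leaf, None)"
| "coprod_tree (Node t s w) =
     lin_ext (\<lambda>(a, b). basis (a, join s b (Some w))) (coprod_tree t)
     + lin_ext (\<lambda>(a, b). basis (join s (Some t) a, b)) (coprod_tree w)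
     - basis (Some t, Some w)"

definition coprod ::
  "('s tree option \<Rightarrow>\<^sub>0 'k::field) \<Rightarrow> ('s tree option \<times> 's tree option \<Rightarrow>\<^sub>0 'k)" where
  "coprod = lin_ext (\<lambda>a. case a of None \<Rightarrow> basis (None, None) | Some t \<Rightarrow> coprod_tree t)"

definition counit :: "('s tree option \<Rightarrow>\<^sub>0 'k::field) \<Rightarrow> 'k" where
  "counit x = Poly_Mapping.lookup x None"

text \<open>Elements of positive degree, not necessarily homogeneous: no component along \<open>1\<^sub>K\<close>.\<close>

definition primitives :: "('s tree option \<Rightarrow>\<^sub>0 'k::field) set" where
  "primitives = {x. Poly_Mapping.lookup x None = 0
     \<and> coprod x = tensor (basis None) x + tensor x (basis None)}"


section \<open>The sets \<open>\<I>\<^sup>S\<^sub>n\<close>\<close>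

definition M_colored :: "pbt \<Rightarrow> 's list \<Rightarrow> ('s tree \<Rightarrow>\<^sub>0 'k::field)" where
  "M_colored t cs =
     (\<Sum>w | tamari_le w t. pscale (of_int (tamari_mu w t)) (basis (colored w cs)))"

definition graft_lin ::
  "('s tree \<Rightarrow>\<^sub>0 'k::field) \<Rightarrow> nat \<Rightarrow> ('s tree \<Rightarrow>\<^sub>0 'k) \<Rightarrow> ('s tree \<Rightarrow>\<^sub>0 'k)" where
  "graft_lin x j = bilin_ext (\<lambda>t w. basis (graft t j w)) x"

text \<open>\<open>graft_all x [w\<^sub>1, \<dots>, w\<^sub>r] = (((x \<circ>\<^sub>r w\<^sub>r) \<circ>\<^sub>r\<^sub>-\<^sub>1 w\<^sub>r\<^sub>-\<^sub>1) \<dots>) \<circ>\<^sub>1 w\<^sub>1\<close>\<close>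

definition graft_all ::
  "('s tree \<Rightarrow>\<^sub>0 'k::field) \<Rightarrow> ('s tree \<Rightarrow>\<^sub>0 'k) list \<Rightarrow> ('s tree \<Rightarrow>\<^sub>0 'k)" where
  "graft_all x ws = foldr (\<lambda>(j, w) y. graft_lin y j w) (zip [1..<Suc (length ws)] ws) x"

text \<open>\<open>hat\<close> is \<open>s - s\<^sub>\<bullet>\<close> in \<open>K[S]\<close>, and \<open>cherry x\<close> is the tree with two leaves colored by \<open>x \<in> K[S]\<close>.\<close>

definition hat :: "'s \<Rightarrow> 's \<Rightarrow> ('s \<Rightarrow>\<^sub>0 'k::field)" where
  "hat sb s = basis s - basis sb"

definition cherry :: "('s \<Rightarrow>\<^sub>0 'k::field) \<Rightarrow> ('s tree \<Rightarrow>\<^sub>0 'k)" where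
  "cherry = lin_ext (\<lambda>s. basis (Node Leaf s Leaf))"

text \<open>
  \<open>(n, x) \<in> I_graded sb\<close> means \<open>x \<in> \<I>\<^sup>S\<^sub>n\<close>. All premises have index below \<open>n\<close>, so the least fixed point
  is the recursion over \<open>n\<close>.
\<close>

inductive_set I_graded :: "'s \<Rightarrow> (nat \<times> ('s tree \<Rightarrow>\<^sub>0 'k::field)) set" for sb :: 's where
  one: "(1, basis Leaf) \<in> I_graded sb"
| two: "s \<noteq> sb \<Longrightarrow> (2, cherry (hat sb s)) \<in> I_graded sb"
| irr: "n > 2 \<Longrightarrow> size1 t = n \<Longrightarrow> rirreducible t \<Longrightarrow> length cs = n - 1
        \<Longrightarrow> (n, M_colored t cs) \<in> I_graded sb"
| comp: "n > 2 \<Longrightarrow> (r, x) \<in> I_graded sb \<Longrightarrow> r < n \<Longrightarrow> length ws = r \<Longrightarrow> sum_list ms = n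
        \<Longrightarrow> list_all2 (\<lambda>m w. m < n \<and> (m, w) \<in> I_graded sb) ms ws
        \<Longrightarrow> (n, graft_all x ws) \<in> I_graded sb"

definition I_set :: "'s \<Rightarrow> nat \<Rightarrow> ('s tree \<Rightarrow>\<^sub>0 'k::field) set" where
  "I_set sb n = {x. (n, x) \<in> I_graded sb}"

text \<open>
  The sum over \<open>n\<close> of the spans \<open>K[\<I>\<^sup>S\<^sub>n]\<close>; it is direct because \<open>I_set sb n\<close> is homogeneous of
  degree \<open>n\<close>.
\<close>

definition KI :: "'s \<Rightarrow> ('s tree \<Rightarrow>\<^sub>0 'k::field) set" where
  "KI sb = pvs.span (\<Union>n\<in>{1..}. pvs.span (I_set sb n))"


section \<open>The cotensor coalgebra\<close>

text \<open>
  The tensor space on the free space on \<open>'b\<close> is the free space on the words \<^typ>\<open>'b list\<close>. For a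
  subspace \<open>V\<close> of the former, \<open>V\<^sup>\<otimes>\<^sup>n\<close> embeds in the latter (we are over a field) as the span of the
  pure tensors \<open>v\<^sub>1 \<otimes> \<dots> \<otimes> v\<^sub>n\<close> with entries in \<open>V\<close>, and deconcatenation of words restricts to
  deconcatenation of such tensors (\<open>deconcat_pure_tensor\<close> below).
\<close>

primrec pure_tensor :: "('b \<Rightarrow>\<^sub>0 'k::field) list \<Rightarrow> ('b list \<Rightarrow>\<^sub>0 'k)" where
  "pure_tensor [] = basis []"
| "pure_tensor (v # vs) = bilin_ext (\<lambda>b bs. basis (b # bs)) v (pure_tensor vs)"

definition tensor_space :: "('b \<Rightarrow>\<^sub>0 'k::field) set \<Rightarrow> ('b list \<Rightarrow>\<^sub>0 'k) set" where
  "tensor_space V = pvs.span {pure_tensor vs | vs. set vs \<subseteq> V}"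

definition deconcat :: "('b list \<Rightarrow>\<^sub>0 'k::field) \<Rightarrow> ('b list \<times> 'b list \<Rightarrow>\<^sub>0 'k)" where
  "deconcat = lin_ext (\<lambda>bs. \<Sum>i\<le>length bs. basis (take i bs, drop i bs))"

definition tensor_counit :: "('b list \<Rightarrow>\<^sub>0 'k::field) \<Rightarrow> 'k" where
  "tensor_counit x = Poly_Mapping.lookup x []"

text \<open>
  \<open>f\<close> is an isomorphism from the coalgebra with coproduct \<open>\<Delta>\<close> and counit \<open>\<epsilon>\<close> on the whole free space
  on \<open>'a\<close> onto the subcoalgebra \<open>D\<close> of a coalgebra with coproduct \<open>\<Delta>'\<close> and counit \<open>\<epsilon>'\<close> on the free
  space on \<open>'b\<close>.
\<close>

definition coalgebra_iso_onto ::
  "(('a \<Rightarrow>\<^sub>0 'k) \<Rightarrow> ('a \<times> 'a \<Rightarrow>\<^sub>0 'k)) \<Rightarrow> (('a \<Rightarrow>\<^sub>0 'k) \<Rightarrow> 'k)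
    \<Rightarrow> (('b \<Rightarrow>\<^sub>0 'k) \<Rightarrow> ('b \<times> 'b \<Rightarrow>\<^sub>0 'k)) \<Rightarrow> (('b \<Rightarrow>\<^sub>0 'k) \<Rightarrow> 'k) \<Rightarrow> ('b \<Rightarrow>\<^sub>0 'k::field) set
    \<Rightarrow> (('a \<Rightarrow>\<^sub>0 'k) \<Rightarrow> ('b \<Rightarrow>\<^sub>0 'k)) \<Rightarrow> bool" where
  "coalgebra_iso_onto \<Delta> \<epsilon> \<Delta>' \<epsilon>' D f \<longleftrightarrow>
     Vector_Spaces.linear pscale pscale f \<and> bij_betw f UNIV D
     \<and> (\<forall>x. \<Delta>' (f x) = tensor_map f f (\<Delta> x)) \<and> (\<forall>x. \<epsilon>' (f x) = \<epsilon> x)"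


subsection \<open>Compatibility of deconcatenation with pure tensors\<close>

lemma lin_ext_superset:
  "finite A \<Longrightarrow> Poly_Mapping.keys x \<subseteq> A
    \<Longrightarrow> lin_ext f x = (\<Sum>a\<in>A. pscale (Poly_Mapping.lookup x a) (f a))"
  unfolding lin_ext_def by (rule sum.mono_neutral_left) (auto simp: in_keys_iff)

lemma linear_lin_ext:
  fixes f :: "'a \<Rightarrow> ('b \<Rightarrow>\<^sub>0 'k::field)"
  shows "Vector_Spaces.linear pscale pscale (lin_ext f)"
proof unfold_locales
  fix x y :: "'a \<Rightarrow>\<^sub>0 'k" and c :: 'k
  have "Poly_Mapping.keys (x + y) \<subseteq> Poly_Mapping.keys x \<union> Poly_Mapping.keys y" by (rule keys_add)
  then show "lin_ext f (x + y) = lin_ext f x + lin_ext f y"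
    by (simp add: lin_ext_superset[of "Poly_Mapping.keys x \<union> Poly_Mapping.keys y"] lookup_add pvs.scale_left_distrib
        sum.distrib)
  have "Poly_Mapping.keys (pscale c x) \<subseteq> Poly_Mapping.keys x" by (auto simp: in_keys_iff)
  then show "lin_ext f (pscale c x) = pscale c (lin_ext f x)"
    by (simp add: lin_ext_superset[of "Poly_Mapping.keys x"] pvs.scale_sum_right)
qed

lemma lin_ext_basis [simp]: "lin_ext f (basis a) = f a"
  by (simp add: lin_ext_def)

lemma lin_ext_add [simp]: "lin_ext f (x + y) = lin_ext f x + lin_ext f y"
  and lin_ext_scale [simp]: "lin_ext f (pscale c x) = pscale c (lin_ext f x)"
  and lin_ext_sum: "lin_ext f (sum g A) = (\<Sum>a\<in>A. lin_ext f (g a))"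
  using linear_lin_ext[of f]
  by (auto simp: Vector_Spaces.linear_def module_hom.add module_hom.scale module_hom.sum)

lemma lin_ext_zero [simp]: "lin_ext f 0 = 0"
  by (simp add: lin_ext_def)

lemma basis_expansion: "x = (\<Sum>b\<in>Poly_Mapping.keys x. pscale (Poly_Mapping.lookup x b) (basis b))"
  by (rule poly_mapping_eqI)
    (auto simp: lookup_sum lookup_single when_def in_keys_iff if_distrib cong: if_cong)

lemma lin_ext_comp: "lin_ext f (lin_ext g x) = lin_ext (\<lambda>a. lin_ext f (g a)) x"
  by (simp add: lin_ext_def[of g] lin_ext_sum) (simp add: lin_ext_def[of _ x])

lemma lin_ext_fun_add: "lin_ext (\<lambda>a. f a + g a) x = lin_ext f x + lin_ext g x"
  by (simp add: lin_ext_def pvs.scale_right_distrib sum.distrib)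

lemma lin_ext_fun_scale: "lin_ext (\<lambda>a. pscale c (f a)) x = pscale c (lin_ext f x)"
  by (simp add: lin_ext_def pvs.scale_sum_right mult.commute)

lemma lin_ext_fun_sum: "lin_ext (\<lambda>a. \<Sum>i\<in>A. f i a) x = (\<Sum>i\<in>A. lin_ext (f i) x)"
  unfolding lin_ext_def by (simp add: pvs.scale_sum_right) (rule sum.swap)

lemma lin_ext_basis_id: "lin_ext basis x = x"
  unfolding lin_ext_def by (rule basis_expansion[symmetric])

lemma tensor_lin_ext_left: "tensor (lin_ext f x) y = lin_ext (\<lambda>a. tensor (f a) y) x"
  by (simp add: tensor_def bilin_ext_def lin_ext_comp)

lemma deconcat_pure_tensor:
  "deconcat (pure_tensor vs) =
     (\<Sum>i\<le>length vs. tensor (pure_tensor (take i vs)) (pure_tensor (drop i vs)))"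
proof (induction vs)
  case Nil
  then show ?case by (simp add: deconcat_def tensor_def bilin_ext_def)
next
  case (Cons v vs)
  define cons1 :: "'a \<Rightarrow> 'a list \<times> 'a list \<Rightarrow> ('a list \<times> 'a list \<Rightarrow>\<^sub>0 'b)"
    where "cons1 b p = basis (b # fst p, snd p)" for b p
  let ?P = "pure_tensor vs"
  have step: "deconcat (basis (b # bs) :: 'a list \<Rightarrow>\<^sub>0 'b) =
      basis ([], b # bs) + lin_ext (cons1 b) (deconcat (basis bs))" for b bs
    by (simp add: deconcat_def lin_ext_sum cons1_def sum.atMost_Suc_shift del: sum.atMost_Suc)
  have cons_tensor: "lin_ext (cons1 b) (tensor x y) = tensor (lin_ext (\<lambda>bs. basis (b # bs)) x) y"
    for b x y
    by (simp add: tensor_def bilin_ext_def lin_ext_comp cons1_def)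
  have "deconcat (pure_tensor (v # vs)) =
      lin_ext (\<lambda>b. lin_ext (\<lambda>bs. deconcat (basis (b # bs))) ?P) v"
    by (simp add: bilin_ext_def deconcat_def lin_ext_comp)
  also have "\<dots> = lin_ext (\<lambda>b. lin_ext (\<lambda>bs. basis ([], b # bs)) ?P) v
      + lin_ext (\<lambda>b. lin_ext (\<lambda>bs. lin_ext (cons1 b) (deconcat (basis bs))) ?P) v"
    by (simp only: step lin_ext_fun_add)
  also have "lin_ext (\<lambda>b. lin_ext (\<lambda>bs. basis ([], b # bs)) ?P) v
      = tensor (pure_tensor []) (pure_tensor (v # vs))"
    by (simp add: tensor_def bilin_ext_def lin_ext_comp)
  also have "lin_ext (\<lambda>b. lin_ext (\<lambda>bs. lin_ext (cons1 b) (deconcat (basis bs))) ?P) v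
      = lin_ext (\<lambda>b. lin_ext (cons1 b) (deconcat ?P)) v"
    by (simp add: deconcat_def lin_ext_comp)
  also have "\<dots> = (\<Sum>i\<le>length vs. tensor (pure_tensor (v # take i vs)) (pure_tensor (drop i vs)))"
    by (simp add: Cons.IH lin_ext_sum cons_tensor lin_ext_fun_sum bilin_ext_def
        tensor_lin_ext_left)
  finally show ?case
    by (simp add: sum.atMost_Suc_shift del: sum.atMost_Suc)
qed

end

theory Submission
  imports Defs
begin

text \<open>
  Cutting a tree at an internal vertex \<open>v\<close> splits its leaves into those to the left and those to the
  right of \<open>v\<close>; the coproduct is the sum of all cuts, forgetting the color of \<open>v\<close>. The colored
  version of the product \<open>rightthreetimes\<close> along \<open>s\<^sub>\<bullet>\<close> is associative and satisfies the unital infinitesimal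
  relation, so, as in the theorem of Loday and Ronco, the coalgebra is cofree over its primitive part,
  onto which there is an explicit idempotent projection \<open>e\<close> that kills all products.

  To identify the primitive part, let \<open>a \<star>\<^sub>s b\<close> and \<open>a \<or>\<^sub>s b\<close> denote that product and the join. Moebius
  inversion gives \<open>M\<^sub>a \<star>\<^sub>s M\<^sub>b = M\<^bsub>a \<star> b\<^esub>\<close>, shows that \<open>M\<^sub>t\<close> is primitive for irreducible \<open>t\<close>, and gives
  \<open>M\<^sub>a \<or>\<^sub>s M\<^sub>b = M\<^sub>a \<star>\<^sub>s M\<^sub>b\<close> modulo terms with fewer irreducible factors when \<open>a\<close> is irreducible. Since grafting
  preserves primitive elements, induction on the number of irreducible factors writes each \<open>M\<^sub>t\<close> as an
  element of \<open>K[\<I>\<^sup>S]\<close> plus products along \<open>s\<^sub>\<bullet>\<close>; applying \<open>e\<close> shows that all primitive elements lie in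
  \<open>K[\<I>\<^sup>S]\<close>.
\<close>

section \<open>Multilinear extension\<close>

lemma lin_ext_cong:
  "(\<And>a. a \<in> Poly_Mapping.keys x \<Longrightarrow> f a = g a) \<Longrightarrow> lin_ext f x = lin_ext g x"
  by (simp add: lin_ext_def)

lemma lin_ext_diff [simp]: "lin_ext f (x - y) = lin_ext f x - lin_ext f y"
  using lin_ext_add[of f "x - y" y] by (simp add: algebra_simps)

lemma lin_ext_fun_diff: "lin_ext (\<lambda>a. f a - g a) x = lin_ext f x - lin_ext g x"
  by (simp add: lin_ext_def pvs.scale_right_diff_distrib sum_subtractf)

lemma lin_ext_fun_zero [simp]: "lin_ext (\<lambda>a. 0) x = 0"
  by (simp add: lin_ext_def)

lemma lin_ext_swap: "lin_ext (\<lambda>a. lin_ext (f a) y) x = lin_ext (\<lambda>b. lin_ext (\<lambda>a. f a b) x) y"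
  unfolding lin_ext_def by (simp add: pvs.scale_sum_right mult.commute) (rule sum.swap)

lemma lin_ext_in_subspace:
  assumes "pvs.subspace W" "\<And>a. a \<in> Poly_Mapping.keys x \<Longrightarrow> f a \<in> W"
  shows "lin_ext f x \<in> W"
  unfolding lin_ext_def using assms by (intro pvs.subspace_sum pvs.subspace_scale) auto

lemma lin_ext_span:
  assumes "x \<in> pvs.span A" "pvs.subspace W" "\<And>a. a \<in> A \<Longrightarrow> lin_ext f a \<in> W"
  shows "lin_ext f x \<in> W"
proof -
  have "pvs.subspace {x. lin_ext f x \<in> W}"
    using assms(2) by (auto simp: pvs.subspace_def)
  then show ?thesis
    using pvs.span_induct[OF assms(1), of "\<lambda>x. lin_ext f x \<in> W"] assms(3) by blast
qed

lemma lin_ext_eqI_span: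
  assumes "x \<in> pvs.span A" "\<And>a. a \<in> A \<Longrightarrow> lin_ext f a = lin_ext g a"
  shows "lin_ext f x = lin_ext g x"
proof -
  have "lin_ext (\<lambda>a. f a - g a) x \<in> {0}"
    by (rule lin_ext_span[OF assms(1)]) (auto simp: lin_ext_fun_diff assms(2))
  then show ?thesis by (simp add: lin_ext_fun_diff)
qed

lemma bilin_ext_basis [simp]: "bilin_ext f (basis a) (basis b) = f a b"
  by (simp add: bilin_ext_def)

lemma bilin_ext_swap: "bilin_ext f x y = bilin_ext (\<lambda>b a. f a b) y x"
  unfolding bilin_ext_def by (rule lin_ext_swap)

lemma bilin_ext_diff_left: "bilin_ext f (x - x') y = bilin_ext f x y - bilin_ext f x' y"
  and bilin_ext_zero_left [simp]: "bilin_ext f 0 y = 0"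
  and bilin_ext_sum_left: "bilin_ext f (sum u A) y = (\<Sum>a\<in>A. bilin_ext f (u a) y)"
  by (simp_all add: bilin_ext_def lin_ext_sum)

lemma bilin_ext_add_right: "bilin_ext f x (y + y') = bilin_ext f x y + bilin_ext f x y'"
  and bilin_ext_zero_right [simp]: "bilin_ext f x 0 = 0"
  and bilin_ext_sum_right: "bilin_ext f x (sum v B) = (\<Sum>b\<in>B. bilin_ext f x (v b))"
  by (simp_all add: bilin_ext_def lin_ext_fun_add lin_ext_fun_diff lin_ext_sum lin_ext_fun_sum)

lemma bilin_ext_span:
  assumes "x \<in> pvs.span A" "y \<in> pvs.span B" "pvs.subspace W"
    and W: "\<And>a b. a \<in> A \<Longrightarrow> b \<in> B \<Longrightarrow> bilin_ext f a b \<in> W"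
  shows "bilin_ext f x y \<in> W"
proof -
  \<comment> \<open>By definition \<open>bilin_ext\<close> is a \<open>lin_ext\<close> in its first
    argument; exchanging the sums makes it one in \<open>y\<close>, to which
    \<open>lin_ext_span\<close> applies.\<close>
  have eq: "bilin_ext f a y = lin_ext (\<lambda>b. lin_ext (\<lambda>a. f a b) a) y" for a y
    by (simp only: bilin_ext_def lin_ext_swap[of f])
  have "bilin_ext f a y \<in> W" if "a \<in> A" for a
    unfolding eq by (rule lin_ext_span[OF assms(2,3)]) (use W[OF that] in \<open>simp add: eq\<close>)
  then show ?thesis
    unfolding bilin_ext_def by (intro lin_ext_span[OF assms(1,3)]) (auto simp: bilin_ext_def)
qed

lemma bilin_ext_lin_ext_left:
  "bilin_ext f (lin_ext g x) y = lin_ext (\<lambda>a. bilin_ext f (g a) y) x"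
  by (simp add: bilin_ext_def lin_ext_comp)

lemma bilin_ext_lin_ext_right:
  "bilin_ext f x (lin_ext g y) = lin_ext (\<lambda>b. bilin_ext f x (g b)) y"
  by (simp only: bilin_ext_swap[of f] bilin_ext_lin_ext_left)

text \<open>\<open>tensor_map\<close> evaluates its arguments on basis elements alone, so the maps
  are written as \<open>lin_ext\<close> to make their linearity visible.\<close>

lemma tensor_map_tensor:
  "tensor_map (lin_ext f) (lin_ext g) (tensor x y) = tensor (lin_ext f x) (lin_ext g y)"
  by (simp add: tensor_map_def tensor_def bilin_ext_def[of "\<lambda>a b. basis (a, b)" x] lin_ext_comp
      bilin_ext_lin_ext_left bilin_ext_lin_ext_right) (rule lin_ext_swap)


section \<open>Cuts of a tree\<close>

fun cuts :: "'s tree \<Rightarrow> ('s tree \<times> 's tree) list" where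
  "cuts Leaf = []"
| "cuts (Node l s r) = map (\<lambda>(p, q). (p, Node q s r)) (cuts l) @ (l, r)
     # map (\<lambda>(p, q). (Node l s p, q)) (cuts r)"

text \<open>Values in any abelian group, since the same identities are applied to trees, words and
  tensors.\<close>

definition cutsum :: "'s tree \<Rightarrow> ('s tree \<Rightarrow> 's tree \<Rightarrow> 'v::ab_group_add) \<Rightarrow> 'v" where
  "cutsum t h = sum_list (map (case_prod h) (cuts t))"

lemma cutsum_Leaf [simp]: "cutsum Leaf h = 0"
  and cutsum_Node [simp]: "cutsum (Node l s r) h =
    cutsum l (\<lambda>p q. h p (Node q s r)) + h l r + cutsum r (\<lambda>p q. h (Node l s p) q)"
  by (simp_all add: cutsum_def comp_def case_prod_unfold add.assoc)

text \<open>As a function congruence rule it hands membership in \<open>cuts t\<close> to the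
  recursions through \<open>cutsum\<close> below; their termination then follows from
  \<open>size_cuts\<close>.\<close>

lemma cutsum_cong [fundef_cong]:
  "t = t' \<Longrightarrow> (\<And>p q. (p, q) \<in> set (cuts t') \<Longrightarrow> h p q = h' p q) \<Longrightarrow> cutsum t h = cutsum t' h'"
  unfolding cutsum_def by (intro arg_cong[where f = sum_list] map_cong) auto

text \<open>The cuts are listed in in-order, so each left part has one vertex more than the previous
  one. Hence a cut is determined by the size of its left part (\<open>cuts_unique\<close>).\<close>

lemma cuts_size: "map (\<lambda>(p, q). size p) (cuts t) = [0..<size t]"
proof (induction t)
  case (Node l s r)
  have "map (\<lambda>(p, q). size p) (cuts (Node l s r)) =
      map (\<lambda>(p, q). size p) (cuts l) @ size l
        # map (\<lambda>i. i + Suc (size l)) (map (\<lambda>(p, q). size p) (cuts r))"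
    by (simp add: comp_def case_prod_unfold add.commute)
  also have "\<dots> = [0..<size l] @ size l # [Suc (size l)..<size r + Suc (size l)]"
    unfolding Node.IH using map_add_upt[of "Suc (size l)" "size r"] by simp
  also have "\<dots> = [0..<size l] @ [size l..<size l + Suc (size r)]"
    by (simp add: upt_conv_Cons add.commute del: upt_Suc)
  also have "\<dots> = [0..<size (Node l s r)]"
    using upt_add_eq_append[of 0 "size l" "Suc (size r)"] by (simp del: upt_Suc)
  finally show ?case .
qed simp

lemma cuts_unique:
  assumes "(p, q) \<in> set (cuts t)" "(p', q') \<in> set (cuts t)" "size p = size p'"
  shows "p = p'" "q = q'"
proof -
  have "distinct (map (\<lambda>(p, q). size p) (cuts t))" by (simp add: cuts_size)
  then have "inj_on (\<lambda>(p, q). size p) (set (cuts t))" by (simp add: distinct_map)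
  from inj_onD[OF this _ assms(1,2)] assms(3) show "p = p'" "q = q'" by auto
qed

lemma cutsum_eq_sum: "cutsum t h = (\<Sum>(p, q)\<in>set (cuts t). h p q)"
proof -
  have "distinct (map (\<lambda>(p, q). size p) (cuts t))" by (simp add: cuts_size)
  then have "distinct (cuts t)" by (simp add: distinct_map)
  then show ?thesis by (simp add: cutsum_def sum_list_distinct_conv_sum_set)
qed

lemma size_cuts: "(p, q) \<in> set (cuts t) \<Longrightarrow> Suc (size p + size q) = size t"
  by (induction t arbitrary: p q) auto

lemma cutsum_add: "cutsum t (\<lambda>p q. g p q + h p q) = cutsum t g + cutsum t h"
  and cutsum_zero [simp]: "cutsum t (\<lambda>p q. 0) = 0"
  by (simp_all add: cutsum_eq_sum case_prod_unfold sum.distrib sum_subtractf)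

lemma cutsum_swap:
  "cutsum t (\<lambda>p q. cutsum w (\<lambda>p' q'. h p q p' q')) = cutsum w (\<lambda>p' q'. cutsum t (\<lambda>p q. h p q p' q'))"
  by (simp add: cutsum_eq_sum case_prod_unfold) (rule sum.swap)

text \<open>Both sides run over pairs of internal vertices and the three pieces they cut off. Two
  vertices in one subtree are covered by induction, one in \<open>l\<close> and one in
  \<open>r\<close> by \<open>cutsum_swap\<close>.\<close>

lemma cutsum_coassoc:
  "cutsum t (\<lambda>p q. cutsum p (\<lambda>p1 p2. h p1 p2 q)) = cutsum t (\<lambda>p q. cutsum q (h p))"
proof (induction t arbitrary: h)
  case (Node l s r)
  show ?case
    by (simp add: cutsum_add Node[symmetric] cutsum_swap[of r l] add.assoc)
qed simp

lemma lin_ext_cutsum: "lin_ext f (cutsum t h) = cutsum t (\<lambda>p q. lin_ext f (h p q))"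
  by (simp add: cutsum_eq_sum lin_ext_sum case_prod_unfold)

lemma bilin_ext_cutsum_left: "bilin_ext f (cutsum t h) y = cutsum t (\<lambda>p q. bilin_ext f (h p q) y)"
  by (simp add: cutsum_eq_sum bilin_ext_sum_left case_prod_unfold)

section \<open>The reduced coproduct and its kernel\<close>

definition rcoprod :: "('s tree \<Rightarrow>\<^sub>0 'k::field) \<Rightarrow> ('s tree \<times> 's tree \<Rightarrow>\<^sub>0 'k)" where
  "rcoprod = lin_ext (\<lambda>t. cutsum t (\<lambda>p q. basis (p, q)))"

lemma lin_ext_rcoprod: "lin_ext (case_prod h) (rcoprod x) = lin_ext (\<lambda>t. cutsum t h) x"
  by (simp add: rcoprod_def lin_ext_comp lin_ext_cutsum)

text \<open>The form in which primitivity is used: every sum over cuts factors linearly through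
  \<open>rcoprod\<close>.\<close>

lemma lin_ext_cutsum_primitive: "rcoprod x = 0 \<Longrightarrow> lin_ext (\<lambda>t. cutsum t h) x = 0"
  using lin_ext_rcoprod[of h x] by simp

text \<open>The root cut of a node arises in both recursive sums, through the neutral
  \<open>None\<close> in \<open>join\<close>; the subtracted basis element leaves it once.\<close>

lemma coprod_tree_eq:
  "coprod_tree t = basis (None, Some t) + basis (Some t, None)
     + cutsum t (\<lambda>p q. basis (Some p, Some q))"
  by (induction t) (simp_all add: lin_ext_cutsum)

lemma incl_eq_iff [simp]: "incl x = incl y \<longleftrightarrow> x = y"
proof
  assume "incl x = incl y"
  then have "lin_ext (case_option 0 basis) (incl x) = lin_ext (case_option 0 basis) (incl y)"
    by simp
  then show "x = y" by (simp add: incl_def lin_ext_comp lin_ext_basis_id)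
qed simp

lemma coprod_incl:
  "coprod (incl x) = tensor (basis None) (incl x) + tensor (incl x) (basis None)
     + lin_ext (\<lambda>(p, q). basis (Some p, Some q)) (rcoprod x)"
  by (simp add: coprod_def incl_def lin_ext_comp coprod_tree_eq lin_ext_fun_add tensor_def
      bilin_ext_def rcoprod_def lin_ext_cutsum)

lemma lookup_incl_None [simp]: "Poly_Mapping.lookup (incl x) None = 0"
  by (simp add: incl_def lin_ext_def lookup_sum lookup_single)

lemma primitives_eq: "primitives = incl ` {x :: 's tree \<Rightarrow>\<^sub>0 'k::field. rcoprod x = 0}"
proof (intro equalityI subsetI)
  fix x :: "'s tree option \<Rightarrow>\<^sub>0 'k"
  assume x: "x \<in> primitives"
  \<comment> \<open>\<open>y\<close> forgets the coefficient at \<open>None\<close>, which is zero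
    for \<open>x\<close>.\<close>
  define y where "y = lin_ext (case_option 0 basis) x"
  have "incl y = lin_ext (\<lambda>a. incl (case_option 0 basis a)) x"
    by (simp add: y_def incl_def lin_ext_comp)
  also have "\<dots> = lin_ext basis x"
  proof (rule lin_ext_cong)
    fix a assume "a \<in> Poly_Mapping.keys x"
    then have "a \<noteq> None" using x by (cases a) (auto simp: primitives_def in_keys_iff)
    then show "incl (case_option 0 basis a) = (basis a :: 's tree option \<Rightarrow>\<^sub>0 'k)"
      by (auto simp: incl_def)
  qed
  finally have y: "incl y = x" by (simp add: lin_ext_basis_id)
  \<comment> \<open>\<open>?r\<close> undoes the embedding of pairs by \<open>Some\<close> in both
    entries, so \<open>rcoprod y\<close> itself vanishes.\<close>
  let ?r = "\<lambda>(a, b). case_option 0 (\<lambda>p. case_option 0 (\<lambda>q. basis (p, q)) b) a"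
  have "lin_ext (\<lambda>(p, q). basis (Some p, Some q)) (rcoprod y) = 0"
    using x coprod_incl[of y] by (simp add: primitives_def y)
  then have "lin_ext ?r (lin_ext (\<lambda>(p, q). basis (Some p, Some q)) (rcoprod y)) = 0" by simp
  then have "rcoprod y = 0"
    by (simp add: lin_ext_comp case_prod_unfold lin_ext_basis_id)
  then show "x \<in> incl ` {x. rcoprod x = 0}" using y by blast
next
  fix x :: "'s tree option \<Rightarrow>\<^sub>0 'k"
  assume "x \<in> incl ` {x. rcoprod x = 0}"
  then show "x \<in> primitives" by (auto simp: primitives_def coprod_incl)
qed


section \<open>The over product and the cofree structure\<close>

text \<open>The colored form of \<open>rprod\<close> along \<open>s\<close>;
  \<open>rprod_eq_over\<close> treats the uncolored case.\<close>

fun rp :: "'s tree \<Rightarrow> 's \<Rightarrow> 's tree \<Rightarrow> 's tree" where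
  "rp t s Leaf = Node t s Leaf"
| "rp t s (Node l u r) = Node (rp t s l) u r"

lemma rp_assoc: "rp a s (rp b u c) = rp (rp a s b) u c"
  by (induction c) auto

lemma size_rp [simp]: "size (rp a s b) = Suc (size a + size b)"
  by (induction b) auto

text \<open>The unital infinitesimal relation: in in-order the vertices of \<open>a\<close> come
  first, then the new vertex, then those of \<open>b\<close>.\<close>

lemma cutsum_rp:
  "cutsum (rp a s b) h = cutsum a (\<lambda>p q. h p (rp q s b)) + h a b + cutsum b (\<lambda>p q. h (rp a s p) q)"
  by (induction b arbitrary: h) (simp_all add: add.assoc)

definition RP :: "'s \<Rightarrow> ('s tree \<Rightarrow>\<^sub>0 'k::field) \<Rightarrow> ('s tree \<Rightarrow>\<^sub>0 'k) \<Rightarrow> ('s tree \<Rightarrow>\<^sub>0 'k)" where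
  "RP s = bilin_ext (\<lambda>a b. basis (rp a s b))"

lemma RP_basis [simp]: "RP s (basis a) (basis b) = basis (rp a s b)"
  by (simp add: RP_def)

lemma RP_assoc: "RP s x (RP u y z) = RP u (RP s x y) z"
  by (simp add: RP_def bilin_ext_def lin_ext_comp rp_assoc)

text \<open>The idempotent \<open>\<Sum>\<^sub>k (-1)\<^sup>k\<^sup>-\<^sup>1 m\<^sup>k \<Delta>\<^sup>k\<close> of the unital infinitesimal bialgebra whose product \<open>m\<close> is
  \<^term>\<open>RP sb\<close>: it projects onto the primitive elements along the decomposable ones.\<close>

function prim_part :: "'s \<Rightarrow> 's tree \<Rightarrow> ('s tree \<Rightarrow>\<^sub>0 'k::field)" where
  "prim_part sb t = basis t - cutsum t (\<lambda>p q. RP sb (prim_part sb p) (basis q))"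
  by pat_completeness auto
termination
  by (relation "measure (\<lambda>(sb, t). size t)") (auto dest: size_cuts)

declare prim_part.simps [simp del]

lemma prim_part_expansion:
  "cutsum t (\<lambda>p q. RP sb (prim_part sb p) (basis q)) = basis t - prim_part sb t"
  by (subst prim_part.simps) simp

lemma rcoprod_basis [simp]: "rcoprod (basis t) = cutsum t (\<lambda>p q. basis (p, q))"
  by (simp add: rcoprod_def)

lemma rcoprod_lin_ext: "rcoprod (lin_ext f x) = lin_ext (\<lambda>a. rcoprod (f a)) x"
  by (simp add: rcoprod_def lin_ext_comp)

lemma rcoprod_RP:
  fixes x :: "'s tree \<Rightarrow>\<^sub>0 'k::field"
  assumes "rcoprod x = 0"
  shows "rcoprod (RP s x (basis b)) = tensor x (basis b) + cutsum b (\<lambda>p q. tensor (RP s x (basis p)) (basis q))"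
proof -
  have "rcoprod (RP s x (basis b)) = lin_ext (\<lambda>a. cutsum (rp a s b) (\<lambda>p q. basis (p, q))) x"
    by (simp add: RP_def bilin_ext_def rcoprod_lin_ext)
  also have "\<dots> = lin_ext (\<lambda>a. basis (a, b)) x
      + lin_ext (\<lambda>a. cutsum b (\<lambda>p q. basis (rp a s p, q))) x"
    by (simp add: cutsum_rp lin_ext_fun_add lin_ext_cutsum_primitive[OF assms])
  also have "lin_ext (\<lambda>a. cutsum b (\<lambda>p q. basis (rp a s p, q))) x
      = cutsum b (\<lambda>p q. lin_ext (\<lambda>a. basis (rp a s p, q)) x)"
    by (simp add: cutsum_eq_sum case_prod_unfold lin_ext_fun_sum)
  finally show ?thesis
    by (simp add: tensor_def RP_def bilin_ext_def lin_ext_comp)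
qed

text \<open>By induction \<open>rcoprod_RP\<close> applies to each \<open>prim_part sb p\<close>.
  Coassociativity moves the second cut into the left part, where \<open>prim_part_expansion\<close>
  collapses it, and what remains is the reduced coproduct of \<open>t\<close>.\<close>

lemma rcoprod_prim_part: "rcoprod (prim_part sb t :: 's tree \<Rightarrow>\<^sub>0 'k::field) = 0"
proof (induction "size t" arbitrary: t rule: less_induct)
  case less
  let ?e = "prim_part sb :: 's tree \<Rightarrow> ('s tree \<Rightarrow>\<^sub>0 'k)"
  have "cutsum t (\<lambda>p q. rcoprod (RP sb (?e p) (basis q)))
      = cutsum t (\<lambda>p q. tensor (?e p) (basis q)
          + cutsum q (\<lambda>q1 q2. tensor (RP sb (?e p) (basis q1)) (basis q2)))"
    using less by (intro cutsum_cong) (auto intro!: rcoprod_RP dest: size_cuts)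
  also have "\<dots> = cutsum t (\<lambda>p q. tensor (?e p) (basis q))
      + cutsum t (\<lambda>p q. cutsum p (\<lambda>p1 p2. tensor (RP sb (?e p1) (basis p2)) (basis q)))"
    by (simp add: cutsum_add cutsum_coassoc)
  also have "cutsum t (\<lambda>p q. cutsum p (\<lambda>p1 p2. tensor (RP sb (?e p1) (basis p2)) (basis q)))
      = cutsum t (\<lambda>p q. tensor (basis p - ?e p) (basis q))"
    by (simp add: tensor_def bilin_ext_cutsum_left[symmetric] prim_part_expansion)
  also have "cutsum t (\<lambda>p q. tensor (?e p) (basis q)) + \<dots> = cutsum t (\<lambda>p q. basis (p, q))"
    by (simp add: cutsum_add[symmetric] tensor_def bilin_ext_diff_left)
  finally show ?case
    by (subst prim_part.simps) (simp add: rcoprod_def lin_ext_cutsum)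
qed

lemma prim_part_primitive:
  assumes "rcoprod x = 0"
  shows "lin_ext (prim_part sb) x = x"
proof -
  have "lin_ext (prim_part sb) x
      = lin_ext (\<lambda>t. basis t - cutsum t (\<lambda>p q. RP sb (prim_part sb p) (basis q))) x"
    by (rule lin_ext_cong) (rule prim_part.simps)
  then show ?thesis
    by (simp add: lin_ext_fun_diff lin_ext_basis_id lin_ext_cutsum_primitive[OF assms])
qed

text \<open>By associativity the cuts in \<open>a\<close> sum to
  \<open>basis (rp a sb b) - RP sb (prim_part sb a) (basis b)\<close>; the cut at the new vertex
  cancels the second term, and the cuts in \<open>b\<close> vanish by induction.\<close>

lemma prim_part_rp: "prim_part sb (rp a sb b) = (0 :: 's tree \<Rightarrow>\<^sub>0 'k::field)"
proof (induction "size b" arbitrary: b rule: less_induct)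
  case less
  let ?e = "prim_part sb :: 's tree \<Rightarrow> ('s tree \<Rightarrow>\<^sub>0 'k)"
  have "cutsum a (\<lambda>p q. RP sb (?e p) (basis (rp q sb b)))
      = RP sb (cutsum a (\<lambda>p q. RP sb (?e p) (basis q))) (basis b)"
    unfolding RP_basis[symmetric] RP_assoc by (simp add: RP_def bilin_ext_cutsum_left)
  also have "\<dots> = basis (rp a sb b) - RP sb (?e a) (basis b)"
    unfolding prim_part_expansion by (simp add: RP_def bilin_ext_diff_left)
  finally have "?e (rp a sb b)
      = - cutsum b (\<lambda>p q. RP sb (?e (rp a sb p)) (basis q))"
    by (subst prim_part.simps) (simp add: cutsum_rp algebra_simps)
  also have "cutsum b (\<lambda>p q. RP sb (?e (rp a sb p)) (basis q)) = cutsum b (\<lambda>p q. 0)"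
    using less by (intro cutsum_cong) (auto simp: RP_def dest: size_cuts)
  finally show ?case by simp
qed

lemma prim_part_RP: "lin_ext (prim_part sb) (RP sb x y) = 0"
  by (simp add: RP_def bilin_ext_def lin_ext_comp prim_part_rp)

section \<open>The isomorphism onto words and its inverse\<close>

abbreviation tcons :: "('b \<Rightarrow>\<^sub>0 'k::field) \<Rightarrow> ('b list \<Rightarrow>\<^sub>0 'k) \<Rightarrow> ('b list \<Rightarrow>\<^sub>0 'k)" where
  "tcons \<equiv> bilin_ext (\<lambda>b bs. basis (b # bs))"

text \<open>The sum over all k of the k-th tensor power of \<open>prim_part\<close> applied to the
  iterated reduced coproduct: the standard map into a cofree coalgebra.\<close>

function tree_words :: "'s \<Rightarrow> 's tree \<Rightarrow> ('s tree list \<Rightarrow>\<^sub>0 'k::field)" where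
  "tree_words sb t = tcons (prim_part sb t) (basis [])
     + cutsum t (\<lambda>p q. tcons (prim_part sb p) (tree_words sb q))"
  by pat_completeness auto
termination
  by (relation "measure (\<lambda>(sb, t). size t)") (auto dest: size_cuts)

declare tree_words.simps [simp del]

definition to_words :: "'s \<Rightarrow> ('s tree option \<Rightarrow>\<^sub>0 'k::field) \<Rightarrow> ('s tree list \<Rightarrow>\<^sub>0 'k)" where
  "to_words sb = lin_ext (case_option (basis []) (tree_words sb))"

fun rp_opt :: "'s \<Rightarrow> 's tree \<Rightarrow> 's tree option \<Rightarrow> 's tree" where
  "rp_opt sb t None = t"
| "rp_opt sb t (Some w) = rp t sb w"

fun word_prod :: "'s \<Rightarrow> 's tree list \<Rightarrow> 's tree option" where
  "word_prod sb [] = None"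
| "word_prod sb (t # ts) = Some (rp_opt sb t (word_prod sb ts))"

text \<open>Multiplication of the letters along \<open>sb\<close>, which inverts
  \<open>to_words\<close> on words in primitive elements.\<close>

definition from_words :: "'s \<Rightarrow> ('s tree list \<Rightarrow>\<^sub>0 'k::field) \<Rightarrow> ('s tree option \<Rightarrow>\<^sub>0 'k)" where
  "from_words sb = lin_ext (\<lambda>ts. basis (word_prod sb ts))"

text \<open>\<open>RP sb\<close> with a second factor that may be the unit;
  \<open>from_words\<close> turns \<open>tcons\<close> into it.\<close>

definition act :: "'s \<Rightarrow> ('s tree \<Rightarrow>\<^sub>0 'k::field) \<Rightarrow> ('s tree option \<Rightarrow>\<^sub>0 'k) \<Rightarrow> ('s tree option \<Rightarrow>\<^sub>0 'k)" where
  "act sb = bilin_ext (\<lambda>t o'. basis (Some (rp_opt sb t o')))"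

lemma act_None: "act sb v (basis None) = incl v"
  and act_Some: "act sb v (basis (Some w)) = incl (RP sb v (basis w))"
  by (simp_all add: act_def incl_def RP_def bilin_ext_def lin_ext_comp)

lemma from_words_tcons: "from_words sb (tcons v y) = act sb v (from_words sb y)"
  by (simp add: from_words_def act_def bilin_ext_def lin_ext_comp)

lemma incl_add [simp]: "incl (x + y) = incl x + incl y"
  and incl_cutsum: "incl (cutsum t h) = cutsum t (\<lambda>p q. incl (h p q))"
  and incl_basis [simp]: "incl (basis t) = basis (Some t)"
  by (simp_all add: incl_def lin_ext_cutsum)

text \<open>Multiplying out the recursion of \<open>tree_words\<close>, with the tails equal to
  \<open>q\<close> by induction, gives the sum in \<open>prim_part_expansion\<close>.\<close>

lemma from_words_tree_words:
  "from_words sb (tree_words sb t) = (basis (Some t) :: 's tree option \<Rightarrow>\<^sub>0 'k::field)"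
proof (induction "size t" arbitrary: t rule: less_induct)
  case less
  let ?e = "prim_part sb :: 's tree \<Rightarrow> ('s tree \<Rightarrow>\<^sub>0 'k)"
  have "from_words sb (tree_words sb t)
      = incl (?e t) + cutsum t (\<lambda>p q. act sb (?e p) (from_words sb (tree_words sb q)))"
    by (subst tree_words.simps, simp add: from_words_tcons[symmetric])
      (simp add: from_words_def lin_ext_cutsum act_def incl_def bilin_ext_def lin_ext_comp)
  also have "cutsum t (\<lambda>p q. act sb (?e p) (from_words sb (tree_words sb q)))
      = cutsum t (\<lambda>p q. incl (RP sb (?e p) (basis q)))"
    using less by (intro cutsum_cong) (auto simp: act_Some dest: size_cuts)
  also have "\<dots> = incl (basis t - ?e t)"
    by (simp add: incl_cutsum[symmetric] prim_part_expansion)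
  finally show ?case by (simp add: incl_def)
qed

lemma from_words_to_words:
  fixes x :: "'s tree option \<Rightarrow>\<^sub>0 'k::field"
  shows "from_words sb (to_words sb x) = x"
proof -
  have "from_words sb (case_option (basis []) (tree_words sb) a)
      = (basis a :: 's tree option \<Rightarrow>\<^sub>0 'k)" for a
    by (cases a) (simp_all add: from_words_tree_words, simp add: from_words_def)
  then show ?thesis
    by (simp add: to_words_def from_words_def lin_ext_comp lin_ext_basis_id)
qed

lemma tcons_lin_ext_prim_part:
  assumes "rcoprod v = 0"
  shows "lin_ext (\<lambda>t. tcons (prim_part sb t) y) v = tcons v y"
  by (simp add: bilin_ext_lin_ext_left[symmetric] prim_part_primitive[OF assms])

lemma to_words_act:
  assumes "rcoprod v = 0"
  shows "to_words sb (act sb v z) = tcons v (to_words sb z)"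
proof -
  have None: "to_words sb (act sb v (basis None)) = tcons v (basis [])"
  proof -
    have "to_words sb (act sb v (basis None)) = lin_ext (tree_words sb) v"
      by (simp add: act_None to_words_def incl_def lin_ext_comp)
    also have "\<dots> = lin_ext (\<lambda>t. tcons (prim_part sb t) (basis [])
        + cutsum t (\<lambda>p q. tcons (prim_part sb p) (tree_words sb q))) v"
      by (rule lin_ext_cong) (rule tree_words.simps)
    finally show ?thesis
      by (simp add: lin_ext_fun_add lin_ext_cutsum_primitive[OF assms]
          tcons_lin_ext_prim_part[OF assms])
  qed
  have Some: "to_words sb (act sb v (basis (Some w))) = tcons v (tree_words sb w)" for w
  proof -
    \<comment> \<open>The uncut tree and the left parts of the cuts in \<open>w\<close> are
      products, so \<open>prim_part\<close> kills them. The cuts in \<open>t\<close> disappear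
      below, because \<open>v\<close> is primitive.\<close>
    have tw: "tree_words sb (rp t sb w)
        = cutsum t (\<lambda>p q. tcons (prim_part sb p) (tree_words sb (rp q sb w)))
          + tcons (prim_part sb t) (tree_words sb w)" for t
      by (subst tree_words.simps) (simp add: cutsum_rp prim_part_rp)
    have "to_words sb (act sb v (basis (Some w))) = lin_ext (\<lambda>t. tree_words sb (rp t sb w)) v"
      by (simp add: act_Some to_words_def incl_def RP_def bilin_ext_def lin_ext_comp)
    also have "\<dots> = lin_ext (\<lambda>t. cutsum t (\<lambda>p q. tcons (prim_part sb p) (tree_words sb (rp q sb w)))
        + tcons (prim_part sb t) (tree_words sb w)) v"
      by (rule lin_ext_cong) (rule tw)
    finally show ?thesis
      by (simp add: lin_ext_fun_add lin_ext_cutsum_primitive[OF assms]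
          tcons_lin_ext_prim_part[OF assms])
  qed
  have "to_words sb (act sb v (basis a)) = tcons v (to_words sb (basis a))" for a
    by (cases a) (simp_all add: None Some, simp_all add: to_words_def)
  \<comment> \<open>Both sides are linear in \<open>z\<close>: the basis case is extended by writing
    \<open>z\<close> as \<open>lin_ext basis z\<close>.\<close>
  then have "lin_ext (\<lambda>a. to_words sb (act sb v (basis a))) z
      = lin_ext (\<lambda>a. tcons v (to_words sb (basis a))) z" by simp
  moreover have "lin_ext (\<lambda>a. to_words sb (act sb v (basis a))) z = to_words sb (act sb v z)"
    unfolding to_words_def act_def
    by (simp only: lin_ext_comp[symmetric] bilin_ext_lin_ext_right[symmetric] lin_ext_basis_id)
  moreover have "lin_ext (\<lambda>a. tcons v (to_words sb (basis a))) z = tcons v (to_words sb z)"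
    unfolding to_words_def
    by (simp only: lin_ext_comp[symmetric] bilin_ext_lin_ext_right[symmetric] lin_ext_basis_id)
  ultimately show ?thesis by simp
qed

lemma to_words_from_words_pure:
  assumes "set vs \<subseteq> {v. rcoprod v = 0}"
  shows "to_words sb (from_words sb (pure_tensor vs)) = pure_tensor vs"
  using assms
proof (induction vs)
  case Nil
  then show ?case by (simp add: from_words_def to_words_def)
qed (simp add: from_words_tcons to_words_act)

lemma to_words_in_tensor_space:
  fixes x :: "'s tree option \<Rightarrow>\<^sub>0 'k::field"
  shows "to_words sb x \<in> tensor_space {v. rcoprod v = 0}"
proof -
  let ?V = "{v :: 's tree \<Rightarrow>\<^sub>0 'k. rcoprod v = 0}"
  let ?D = "tensor_space ?V"
  have sub: "pvs.subspace ?D" by (simp add: tensor_space_def)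
  have cons: "tcons v y \<in> ?D" if "v \<in> ?V" "y \<in> ?D" for v y
  proof -
    have "tcons v y \<in> ?D" if y: "y \<in> {pure_tensor vs | vs. set vs \<subseteq> ?V}" for y
    proof -
      obtain vs where "y = pure_tensor vs" "set vs \<subseteq> ?V" using y by blast
      then have "tcons v y = pure_tensor (v # vs)" "set (v # vs) \<subseteq> ?V"
        using \<open>v \<in> ?V\<close> by auto
      then show ?thesis unfolding tensor_space_def by (blast intro: pvs.span_base)
    qed
    then show ?thesis
      using that(2) bilin_ext_span[of v "{v}" y "{pure_tensor vs | vs. set vs \<subseteq> ?V}" ?D "\<lambda>b bs. basis (b # bs)"] sub
      by (auto simp: pvs.span_base tensor_space_def)
  qed
  have nil: "basis [] \<in> ?D"
    unfolding tensor_space_def by (rule pvs.span_base) (auto intro: exI[of _ "[]"])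
  have "tree_words sb t \<in> ?D" for t
  proof (induction "size t" arbitrary: t rule: less_induct)
    case less
    have "cutsum t (\<lambda>p q. tcons (prim_part sb p) (tree_words sb q)) \<in> ?D"
      unfolding cutsum_eq_sum
      by (intro pvs.subspace_sum[OF sub])
        (auto simp: rcoprod_prim_part intro!: cons less dest: size_cuts)
    then show ?case
      by (subst tree_words.simps) (auto simp: rcoprod_prim_part intro!: cons nil pvs.subspace_add[OF sub])
  qed
  then show ?thesis
    unfolding to_words_def by (intro lin_ext_in_subspace sub) (auto simp: nil split: option.split)
qed

text \<open>The unreduced form of \<open>rcoprod_RP\<close>; the term with \<open>v\<close> alone on
  the left comes from \<open>act_None\<close>.\<close>

lemma coprod_act:
  assumes "rcoprod v = 0"
  shows "coprod (act sb v z) = tensor (basis None) (act sb v z)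
     + lin_ext (\<lambda>(a, b). tensor (act sb v (basis a)) (basis b)) (coprod z)"
proof -
  let ?T = "\<lambda>z. lin_ext (\<lambda>(a, b). tensor (act sb v (basis a)) (basis b)) (coprod z)"
  have "coprod (act sb v (basis a)) = tensor (basis None) (act sb v (basis a)) + ?T (basis a)" for a
  proof (cases a)
    case None
    then show ?thesis by (simp add: act_None coprod_incl assms) (simp add: coprod_def act_None)
  next
    case (Some w)
    have i: "tensor (incl x) (basis (Some y)) = lin_ext (\<lambda>(p, q). basis (Some p, Some q)) (tensor x (basis y))"
      for x :: "'a tree \<Rightarrow>\<^sub>0 'b" and y
      by (simp add: tensor_def bilin_ext_def incl_def lin_ext_comp)
    have "?T (basis a) = tensor (act sb v (basis None)) (basis (Some w))
        + tensor (act sb v (basis (Some w))) (basis None)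
        + cutsum w (\<lambda>p q. tensor (act sb v (basis (Some p))) (basis (Some q)))"
      by (simp add: Some coprod_def coprod_tree_eq lin_ext_cutsum)
    then show ?thesis
      by (simp add: Some act_None act_Some coprod_incl rcoprod_RP[OF assms] i lin_ext_cutsum)
  qed
  then have "lin_ext (\<lambda>a. coprod (act sb v (basis a))) z
      = lin_ext (\<lambda>a. tensor (basis None) (act sb v (basis a))) z + lin_ext (\<lambda>a. ?T (basis a)) z"
    by (simp add: lin_ext_fun_add)
  moreover have "lin_ext (\<lambda>a. coprod (act sb v (basis a))) z = coprod (act sb v z)"
    unfolding coprod_def act_def
    by (simp only: lin_ext_comp[symmetric] bilin_ext_lin_ext_right[symmetric] lin_ext_basis_id)
  moreover have "lin_ext (\<lambda>a. tensor (basis None) (act sb v (basis a))) z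
      = tensor (basis None) (act sb v z)"
    unfolding tensor_def act_def
    by (simp only: bilin_ext_lin_ext_right[symmetric] lin_ext_basis_id)
  moreover have "lin_ext (\<lambda>a. ?T (basis a)) z = ?T z"
    unfolding coprod_def by (simp only: lin_ext_comp[symmetric] lin_ext_basis_id)
  ultimately show ?thesis by simp
qed

text \<open>Each use of \<open>coprod_act\<close> adds the split before \<open>v\<close> and
  prepends \<open>v\<close> to the left part of all other splits, which is the recursion of
  deconcatenation.\<close>

lemma coprod_from_words_pure:
  fixes vs :: "('s tree \<Rightarrow>\<^sub>0 'k::field) list"
  assumes "set vs \<subseteq> {v. rcoprod v = 0}"
  shows "coprod (from_words sb (pure_tensor vs)) = (\<Sum>i\<le>length vs.
    tensor (from_words sb (pure_tensor (take i vs))) (from_words sb (pure_tensor (drop i vs))))"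
  using assms
proof (induction vs)
  case Nil
  then show ?case by (simp add: from_words_def coprod_def tensor_def)
next
  case (Cons v vs)
  have t: "lin_ext (\<lambda>(a, b). tensor (act sb v (basis a)) (basis b)) (tensor x y) = tensor (act sb v x) y"
    for x y
  proof -
    have "lin_ext (\<lambda>(a, b). tensor (act sb v (basis a)) (basis b)) (tensor x y)
        = lin_ext (\<lambda>a. lin_ext (\<lambda>b. tensor (act sb v (basis a)) (basis b)) y) x"
      by (simp add: tensor_def bilin_ext_def lin_ext_comp)
    also have "\<dots> = lin_ext (\<lambda>a. tensor (act sb v (basis a)) y) x"
      unfolding tensor_def by (simp only: bilin_ext_lin_ext_right[symmetric] lin_ext_basis_id)
    also have "\<dots> = tensor (act sb v x) y"
      unfolding tensor_def act_def
      by (simp only: bilin_ext_lin_ext_left[symmetric] bilin_ext_lin_ext_right[symmetric] lin_ext_basis_id)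
    finally show ?thesis .
  qed
  from Cons.prems have v: "rcoprod v = 0" by simp
  have "from_words sb (pure_tensor []) = (basis None :: 's tree option \<Rightarrow>\<^sub>0 'k)"
    by (simp add: from_words_def)
  then show ?case
    using Cons by (simp add: from_words_tcons coprod_act[OF v] t lin_ext_sum sum.atMost_Suc_shift
        del: sum.atMost_Suc pure_tensor.simps(1))
qed

lemma linear_to_words: "Vector_Spaces.linear pscale pscale (to_words sb)"
  unfolding to_words_def by (rule linear_lin_ext)

lemma tensor_counit_to_words:
  fixes x :: "'s tree option \<Rightarrow>\<^sub>0 'k::field"
  shows "tensor_counit (to_words sb x) = counit x"
proof -
  have "Poly_Mapping.lookup (tree_words sb t) [] = (0 :: 'k)" for t
    by (subst tree_words.simps)
      (simp add: lookup_add cutsum_eq_sum lookup_sum case_prod_unfold bilin_ext_def lin_ext_def lookup_single)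
  then have "Poly_Mapping.lookup (case_option (basis []) (tree_words sb) a) [] = (if a = None then 1 else 0 :: 'k)"
    for a
    by (cases a) simp_all
  then have "tensor_counit (to_words sb x)
      = (\<Sum>a\<in>Poly_Mapping.keys x. Poly_Mapping.lookup x a * (if a = None then 1 else 0))"
    by (simp add: tensor_counit_def to_words_def lin_ext_def lookup_sum)
  also have "\<dots> = counit x"
    by (simp add: counit_def in_keys_iff if_distrib sum.delta cong: if_cong)
  finally show ?thesis .
qed

text \<open>\<open>from_words\<close> respects the coproducts on pure tensors, which span the
  target; the bijection carries this over to \<open>to_words\<close>.\<close>

theorem coalgebra_iso_to_words:
  "coalgebra_iso_onto coprod counit deconcat tensor_counit
     (tensor_space {v :: 's tree \<Rightarrow>\<^sub>0 'k::field. rcoprod v = 0}) (to_words sb)"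
proof -
  let ?V = "{v :: 's tree \<Rightarrow>\<^sub>0 'k. rcoprod v = 0}"
  let ?P = "{pure_tensor vs | vs. set vs \<subseteq> ?V}"
  let ?D = "tensor_space ?V"
  have fg: "to_words sb (from_words sb y) = y" if "y \<in> ?D" for y
  proof -
    \<comment> \<open>The composite is written as a single \<open>lin_ext\<close>, so that it can be
      compared with the identity on the spanning set.\<close>
    have "lin_ext (\<lambda>ts. to_words sb (basis (word_prod sb ts))) y = lin_ext basis y"
      using that unfolding tensor_space_def
    proof (rule lin_ext_eqI_span)
      fix p assume "p \<in> ?P"
      then show "lin_ext (\<lambda>ts. to_words sb (basis (word_prod sb ts))) p = lin_ext basis p"
        using to_words_from_words_pure[of _ sb]
        by (auto simp: lin_ext_basis_id to_words_def from_words_def lin_ext_comp)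
    qed
    then show ?thesis
      by (simp add: lin_ext_basis_id to_words_def from_words_def lin_ext_comp)
  qed
  have "bij_betw (to_words sb) UNIV ?D"
    by (rule bij_betw_byWitness[where f' = "from_words sb"])
      (auto simp: from_words_to_words fg to_words_in_tensor_space)
  moreover have "deconcat (to_words sb x) = tensor_map (to_words sb) (to_words sb) (coprod x)"
    for x :: "'s tree option \<Rightarrow>\<^sub>0 'k"
  proof -
    have "deconcat y = tensor_map (to_words sb) (to_words sb) (coprod (from_words sb y))"
      if "y \<in> ?D" for y
    proof -
      have "lin_ext (\<lambda>bs. \<Sum>i\<le>length bs. basis (take i bs, drop i bs)) y
          = lin_ext (\<lambda>ts. tensor_map (to_words sb) (to_words sb) (coprod (basis (word_prod sb ts)))) y"
        using that unfolding tensor_space_def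
      proof (rule lin_ext_eqI_span)
        fix p assume "p \<in> ?P"
        then obtain vs where p: "p = pure_tensor vs" and vs: "set vs \<subseteq> ?V" by blast
        have pt: "to_words sb (from_words sb (pure_tensor (take i vs))) = pure_tensor (take i vs)"
            "to_words sb (from_words sb (pure_tensor (drop i vs))) = pure_tensor (drop i vs)" for i
          using vs by (auto intro!: to_words_from_words_pure dest: in_set_takeD in_set_dropD)
        have "tensor_map (to_words sb) (to_words sb) (coprod (from_words sb p)) = deconcat p"
        proof -
          have "tensor_map (to_words sb) (to_words sb) (coprod (from_words sb p))
              = (\<Sum>i\<le>length vs. tensor_map (to_words sb) (to_words sb)
                  (tensor (from_words sb (pure_tensor (take i vs))) (from_words sb (pure_tensor (drop i vs)))))"
            unfolding p coprod_from_words_pure[OF vs] by (simp add: tensor_map_def lin_ext_sum)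
          also have "\<dots> = (\<Sum>i\<le>length vs. tensor (to_words sb (from_words sb (pure_tensor (take i vs))))
                  (to_words sb (from_words sb (pure_tensor (drop i vs)))))"
            unfolding to_words_def tensor_map_tensor ..
          finally show ?thesis by (simp add: pt p deconcat_pure_tensor)
        qed
        then show "lin_ext (\<lambda>bs. \<Sum>i\<le>length bs. basis (take i bs, drop i bs)) p
          = lin_ext (\<lambda>ts. tensor_map (to_words sb) (to_words sb) (coprod (basis (word_prod sb ts)))) p"
          by (simp add: deconcat_def tensor_map_def from_words_def coprod_def lin_ext_comp)
      qed
      then show ?thesis
        by (simp add: deconcat_def tensor_map_def from_words_def coprod_def lin_ext_comp)
    qed
    from this[OF to_words_in_tensor_space] show ?thesis by (simp add: from_words_to_words)
  qed
  ultimately show ?thesis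
    by (simp add: coalgebra_iso_onto_def linear_to_words tensor_counit_to_words)
qed


section \<open>Down-sets in the Tamari order\<close>

abbreviation down :: "pbt \<Rightarrow> pbt set" where
  "down t \<equiv> {w. tamari_le w t}"

abbreviation over :: "pbt \<Rightarrow> pbt \<Rightarrow> pbt" where
  "over a b \<equiv> rp a () b"

lemma rprod_eq_over: "rprod = over"
proof (intro ext)
  fix a b
  show "rprod a b = over a b"
    unfolding rprod_def by (induction b) (auto simp: Suc_le_eq)
qed

lemma tamari_Leaf [simp]: "tamari_le w Leaf \<longleftrightarrow> w = Leaf"
  by (auto dest: tamari_size intro: tamari_le.refl)

section \<open>Cuts and over products in the Tamari order\<close>

lemma in_cuts_Node:
  "(p, q) \<in> set (cuts (Node l s r)) \<longleftrightarrow>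
     (\<exists>q'. (p, q') \<in> set (cuts l) \<and> q = Node q' s r) \<or> (p = l \<and> q = r)
     \<or> (\<exists>p'. (p', q) \<in> set (cuts r) \<and> p = Node l s p')"
  by (auto simp: image_iff)

lemma cuts_Node_left: "(p, q) \<in> set (cuts l) \<Longrightarrow> (p, Node q s r) \<in> set (cuts (Node l s r))"
  and cuts_Node_root: "(l, r) \<in> set (cuts (Node l s r))"
  and cuts_Node_right: "(p, q) \<in> set (cuts r) \<Longrightarrow> (Node l s p, q) \<in> set (cuts (Node l s r))"
  unfolding in_cuts_Node by simp_all

text \<open>Cuts at the same in-order position are compared. A rotation changes the parts only for
  cuts in \<open>t1\<close> or \<open>t3\<close>, and then it survives as a rotation of one
  part.\<close>

lemma tamari_cut:
  "tamari_le t t' \<Longrightarrow> (p, q) \<in> set (cuts t)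
    \<Longrightarrow> \<exists>p' q'. (p', q') \<in> set (cuts t') \<and> tamari_le p p' \<and> tamari_le q q'"
proof (induction arbitrary: p q rule: tamari_le.induct)
  case (rot t1 t2 t3)
  have I: ?case if "(p', q') \<in> set (cuts (Node t1 () (Node t2 () t3)))" "tamari_le p p'" "tamari_le q q'"
    for p' q'
    using that by blast
  from rot consider b where "(p, b) \<in> set (cuts t1)" "q = Node (Node b () t2) () t3"
    | "p = t1" "q = Node t2 () t3"
    | a b where "(a, b) \<in> set (cuts t2)" "p = Node t1 () a" "q = Node b () t3"
    | "p = Node t1 () t2" "q = t3"
    | a where "(a, q) \<in> set (cuts t3)" "p = Node (Node t1 () t2) () a"
    unfolding in_cuts_Node by blast
  then show ?case
  proof cases
    case 1
    show ?thesis
      by (rule I[OF cuts_Node_left[OF 1(1)] tamari_le.refl]) (simp add: 1 tamari_le.rot)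
  next
    case 2
    show ?thesis by (rule I[OF cuts_Node_root]) (simp_all add: 2 tamari_le.refl)
  next
    case 3
    show ?thesis
      by (rule I[OF cuts_Node_right[OF cuts_Node_left[OF 3(1)]]]) (simp_all add: 3 tamari_le.refl)
  next
    case 4
    show ?thesis
      by (rule I[OF cuts_Node_right[OF cuts_Node_root]]) (simp_all add: 4 tamari_le.refl)
  next
    case 5
    show ?thesis
      by (rule I[OF cuts_Node_right[OF cuts_Node_right[OF 5(1)]]])
        (simp_all add: 5 tamari_le.refl tamari_le.rot)
  qed
next
  case (left t t' w)
  have I: ?case if "(p', q') \<in> set (cuts (Node t' () w))" "tamari_le p p'" "tamari_le q q'" for p' q'
    using that by blast
  from left.prems consider b where "(p, b) \<in> set (cuts t)" "q = Node b () w"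
    | "p = t" "q = w" | a where "(a, q) \<in> set (cuts w)" "p = Node t () a"
    unfolding in_cuts_Node by blast
  then show ?case
  proof cases
    case 1
    obtain p' b' where "(p', b') \<in> set (cuts t')" "tamari_le p p'" "tamari_le b b'"
      using left.IH[OF 1(1)] by blast
    then show ?thesis by (intro I[OF cuts_Node_left]) (auto simp: 1 intro: tamari_le.left)
  next
    case 2
    show ?thesis by (rule I[OF cuts_Node_root]) (simp_all add: 2 left.hyps tamari_le.refl)
  next
    case 3
    show ?thesis
      by (rule I[OF cuts_Node_right[OF 3(1)]]) (simp_all add: 3 left.hyps tamari_le.left tamari_le.refl)
  qed
next
  case (right w w' t)
  have I: ?case if "(p', q') \<in> set (cuts (Node t () w'))" "tamari_le p p'" "tamari_le q q'" for p' q'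
    using that by blast
  from right.prems consider b where "(p, b) \<in> set (cuts t)" "q = Node b () w"
    | "p = t" "q = w" | a where "(a, q) \<in> set (cuts w)" "p = Node t () a"
    unfolding in_cuts_Node by blast
  then show ?case
  proof cases
    case 1
    show ?thesis
      by (rule I[OF cuts_Node_left[OF 1(1)]]) (simp_all add: 1 right.hyps tamari_le.right tamari_le.refl)
  next
    case 2
    show ?thesis by (rule I[OF cuts_Node_root]) (simp_all add: 2 right.hyps tamari_le.refl)
  next
    case 3
    obtain a' q' where "(a', q') \<in> set (cuts w')" "tamari_le a a'" "tamari_le q q'"
      using right.IH[OF 3(1)] by blast
    then show ?thesis by (intro I[OF cuts_Node_right]) (auto simp: 3 intro: tamari_le.right)
  qed
next
  case (trans t u w)
  obtain p1 q1 where 1: "(p1, q1) \<in> set (cuts u)" "tamari_le p p1" "tamari_le q q1"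
    using trans.IH(1)[OF trans.prems] by blast
  obtain p2 q2 where "(p2, q2) \<in> set (cuts w)" "tamari_le p1 p2" "tamari_le q1 q2"
    using trans.IH(2)[OF 1(1)] by blast
  then show ?case using 1 tamari_le.trans by blast
next
  case (refl t)
  then show ?case using tamari_le.refl by blast
qed

lemma over_mono_left: "tamari_le a a' \<Longrightarrow> tamari_le (over a b) (over a' b)"
  by (induction b) (auto intro: tamari_le.left)

lemma over_mono_right: "tamari_le b b' \<Longrightarrow> tamari_le (over a b) (over a b')"
  by (induction rule: tamari_le.induct) (auto intro: tamari_le.intros)

lemma over_mono: "tamari_le a a' \<Longrightarrow> tamari_le b b' \<Longrightarrow> tamari_le (over a b) (over a' b')"
  by (blast intro: over_mono_left over_mono_right tamari_le.trans)

lemma over_le_Node: "tamari_le (over a b) (Node a () b)"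
proof (induction b)
  case (Node l u r)
  then show ?case by (auto intro: tamari_le.intros)
qed (auto intro: tamari_le.refl)

lemma over_Node_le: "tamari_le (over (Node l () p) q) (Node l () (over p q))"
proof (induction q)
  case (Node q1 u q2)
  then show ?case by (auto intro: tamari_le.intros)
qed (auto intro: tamari_le.rot)

lemma over_cut_le: "(p, q) \<in> set (cuts t) \<Longrightarrow> tamari_le (over p q) t"
proof (induction t arbitrary: p q)
  case (Node l u r)
  then consider b where "(p, b) \<in> set (cuts l)" "q = Node b () r" | "p = l" "q = r"
    | a where "(a, q) \<in> set (cuts r)" "p = Node l () a"
    unfolding in_cuts_Node by fastforce
  then show ?case
  proof cases
    case 1
    then show ?thesis using Node.IH(1) by (auto intro: tamari_le.left)
  next
    case 2
    then show ?thesis using over_le_Node by simp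
  next
    case 3
    then have "tamari_le (Node l () (over a q)) (Node l () r)"
      using Node.IH(2) by (blast intro: tamari_le.right)
    then show ?thesis using 3 over_Node_le[of l a q] by (auto intro: tamari_le.trans)
  qed
qed simp

lemma cut_over: "(a, b) \<in> set (cuts (rp a s b))"
  by (induction b) force+

text \<open>Forwards, \<open>tamari_cut\<close> transports the cut \<open>(a, b)\<close> of
  \<open>over a b\<close> to \<open>t\<close>; backwards, reassembling the parts of a cut can only
  go down.\<close>

lemma over_le_iff:
  "tamari_le (over a b) t \<longleftrightarrow> (\<exists>p q. (p, q) \<in> set (cuts t) \<and> tamari_le a p \<and> tamari_le b q)"
proof
  assume "tamari_le (over a b) t"
  from tamari_cut[OF this cut_over]
  show "\<exists>p q. (p, q) \<in> set (cuts t) \<and> tamari_le a p \<and> tamari_le b q" by blast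
next
  assume "\<exists>p q. (p, q) \<in> set (cuts t) \<and> tamari_le a p \<and> tamari_le b q"
  then obtain p q where "(p, q) \<in> set (cuts t)" "tamari_le a p" "tamari_le b q" by blast
  then show "tamari_le (over a b) t"
    using over_cut_le[of p q t] over_mono[of a p b q] tamari_le.trans by blast
qed

text \<open>The sizes must agree because associativity allows several factorizations; a cut with a
  left part of given size is unique.\<close>

lemma rp_inject:
  assumes "rp a s b = rp a' s b'" "size a = size a'"
  shows "a = a' \<and> b = b'"
proof -
  have "(a', b') \<in> set (cuts (rp a s b))" using cut_over[of a' b' s] assms(1) by simp
  from cuts_unique[OF cut_over this assms(2)] show ?thesis by simp
qed

text \<open>The vertex joining \<open>a\<close> and \<open>b\<close> lies on the left spine and has
  a leaf on its right, so a downward rotation never involves it and acts inside \<open>a\<close> or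
  inside \<open>b\<close>.\<close>

lemma below_over:
  "tamari_le v w \<Longrightarrow> w = over a b \<Longrightarrow> \<exists>a' b'. v = over a' b' \<and> tamari_le a' a \<and> tamari_le b' b"
proof (induction arbitrary: a b rule: tamari_le.induct)
  case (rot t1 t2 t3)
  then obtain b1 where b: "b = Node b1 () (Node t2 () t3)" "t1 = over a b1" by (cases b) auto
  then have "Node (Node t1 () t2) () t3 = over a (Node (Node b1 () t2) () t3)" by simp
  then show ?case using b by (blast intro: tamari_le.intros)
next
  case (left t t' w)
  show ?case
  proof (cases b)
    case Leaf
    then have "Node t () w = over t Leaf" "tamari_le t a" using left by auto
    then show ?thesis using Leaf by (blast intro: tamari_le.refl)
  next
    case (Node b1 u b2)
    then obtain a' b1' where "t = over a' b1'" "tamari_le a' a" "tamari_le b1' b1"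
      using left.IH[of a b1] left.prems by auto
    moreover from this have "Node t () w = over a' (Node b1' () b2)" using Node left by simp
    ultimately show ?thesis
      using Node by (intro exI[of _ a'] exI[of _ "Node b1' () b2"]) (auto intro: tamari_le.left)
  qed
next
  case (right w w' t)
  show ?case
  proof (cases b)
    case Leaf
    then have "Node t () w = over t Leaf" "t = a" using right by auto
    then show ?thesis using Leaf by (blast intro: tamari_le.refl)
  next
    case (Node b1 u b2)
    then have "Node t () w = over a (Node b1 () w)" using right by simp
    then show ?thesis using Node right
      by (intro exI[of _ a] exI[of _ "Node b1 () w"]) (auto intro: tamari_le.right tamari_le.refl)
  qed
next
  case (trans t u w)
  obtain a1 b1 where 1: "u = over a1 b1" "tamari_le a1 a" "tamari_le b1 b"
    using trans.IH(2)[OF trans.prems] by blast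
  obtain a2 b2 where "t = over a2 b2" "tamari_le a2 a1" "tamari_le b2 b1"
    using trans.IH(1)[OF 1(1)] by blast
  then show ?case using 1 by (blast intro: tamari_le.trans)
qed (blast intro: tamari_le.refl)

lemma down_over: "down (over a b) = (\<lambda>(a', b'). over a' b') ` (down a \<times> down b)"
proof (intro equalityI subsetI)
  fix w assume "w \<in> down (over a b)"
  then show "w \<in> (\<lambda>(a', b'). over a' b') ` (down a \<times> down b)"
    using below_over[of w "over a b" a b] by auto
qed (auto intro: over_mono)

text \<open>The trees obtained by inserting a new vertex with left subtree \<open>a\<close> on the left spine of \<open>b\<close>:
  all those with the cut \<open>(a, b)\<close> whose cut vertex lies on the left spine.\<close>

fun spine_inserts :: "pbt \<Rightarrow> pbt \<Rightarrow> pbt set" where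
  "spine_inserts a Leaf = {Node a () Leaf}"
| "spine_inserts a (Node l u r) = insert (Node a () (Node l u r)) ((\<lambda>x. Node x u r) ` spine_inserts a l)"

lemma finite_spine_inserts: "finite (spine_inserts a b)"
  by (induction b) auto

lemma Node_in_spine_inserts: "Node a () b \<in> spine_inserts a b"
  by (cases b) auto

lemma over_in_spine_inserts: "over a b \<in> spine_inserts a b"
  by (induction b) auto

lemma cut_spine_inserts: "w \<in> spine_inserts a b \<Longrightarrow> (a, b) \<in> set (cuts w)"
proof (induction b arbitrary: w)
  case (Node l u r)
  then show ?case by (auto simp: in_cuts_Node simp del: cuts.simps(2))
qed auto

lemma spine_inserts_le: "w \<in> spine_inserts a b \<Longrightarrow> tamari_le w (Node a () b)"
proof (induction b arbitrary: w)
  case (Node l u r)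
  show ?case
  proof (cases "w = Node a () (Node l u r)")
    case False
    then obtain x where x: "w = Node x () r" "x \<in> spine_inserts a l" using Node.prems by auto
    then have "tamari_le w (Node (Node a () l) () r)" using Node.IH(1) by (auto intro: tamari_le.left)
    then show ?thesis by (auto intro: tamari_le.rot tamari_le.trans)
  qed (simp add: tamari_le.refl)
qed (simp add: tamari_le.refl)

text \<open>A downward rotation at the inserted vertex moves it one step down the left spine and
  keeps \<open>a\<close> and \<open>b\<close>; any other acts inside \<open>a\<close> or inside
  \<open>b\<close>.\<close>

lemma below_spine_inserts:
  "tamari_le v w \<Longrightarrow> w \<in> spine_inserts a b
    \<Longrightarrow> \<exists>a' b'. v \<in> spine_inserts a' b' \<and> tamari_le a' a \<and> tamari_le b' b"
proof (induction arbitrary: a b rule: tamari_le.induct)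
  case (rot t1 t2 t3)
  then consider "t1 = a" "b = Node t2 () t3"
    | b1 where "b = Node b1 () (Node t2 () t3)" "t1 \<in> spine_inserts a b1"
    by (cases b) auto
  then show ?case
  proof cases
    case 1
    then have "Node (Node t1 () t2) () t3 \<in> spine_inserts a (Node t2 () t3)"
      using Node_in_spine_inserts[of a t2] by auto
    then show ?thesis using 1 by (blast intro: tamari_le.refl)
  next
    case 2
    then have "Node (Node t1 () t2) () t3 \<in> spine_inserts a (Node (Node b1 () t2) () t3)" by auto
    then show ?thesis using 2 by (blast intro: tamari_le.intros)
  qed
next
  case (left t t' w)
  then consider "t' = a" "w = b" | b1 where "b = Node b1 () w" "t' \<in> spine_inserts a b1"
    by (cases b) auto
  then show ?case
  proof cases
    case 1
    then show ?thesis using left Node_in_spine_inserts[of t b] by (blast intro: tamari_le.refl)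
  next
    case 2
    then obtain a' b1' where "t \<in> spine_inserts a' b1'" "tamari_le a' a" "tamari_le b1' b1"
      using left by blast
    moreover from this have "Node t () w \<in> spine_inserts a' (Node b1' () w)" by auto
    ultimately show ?thesis using 2 by (blast intro: tamari_le.left)
  qed
next
  case (right w w' t)
  then consider "t = a" "w' = b" | b1 where "b = Node b1 () w'" "t \<in> spine_inserts a b1"
    by (cases b) auto
  then show ?case
  proof cases
    case 1
    then show ?thesis using right Node_in_spine_inserts[of t w] by (blast intro: tamari_le.refl)
  next
    case 2
    then have "Node t () w \<in> spine_inserts a (Node b1 () w)" by auto
    then show ?thesis using 2 right by (blast intro: tamari_le.intros)
  qed
next
  case (trans t u w)
  obtain a1 b1 where 1: "u \<in> spine_inserts a1 b1" "tamari_le a1 a" "tamari_le b1 b"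
    using trans.IH(2)[OF trans.prems] by blast
  obtain a2 b2 where "t \<in> spine_inserts a2 b2" "tamari_le a2 a1" "tamari_le b2 b1"
    using trans.IH(1)[OF 1(1)] by blast
  then show ?case using 1 by (blast intro: tamari_le.trans)
qed (blast intro: tamari_le.refl)

lemma down_Node:
  "down (Node a () b) = (\<Union>(a', b')\<in>down a \<times> down b. spine_inserts a' b')"
proof (intro equalityI subsetI)
  fix w assume "w \<in> down (Node a () b)"
  then show "w \<in> (\<Union>(a', b')\<in>down a \<times> down b. spine_inserts a' b')"
    using below_spine_inserts[OF _ Node_in_spine_inserts] by fastforce
next
  fix w assume "w \<in> (\<Union>(a', b')\<in>down a \<times> down b. spine_inserts a' b')"
  then obtain a' b' where "tamari_le a' a" "tamari_le b' b" "w \<in> spine_inserts a' b'" by auto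
  then show "w \<in> down (Node a () b)"
    using spine_inserts_le[of w a' b'] tamari_le.left[of a' a b'] tamari_le.right[of b' b a]
      tamari_le.trans[of w "Node a' () b'" "Node a () b'"] tamari_le.trans[of w "Node a () b'" "Node a () b"]
    by simp
qed

text \<open>The number of factors in the factorization into \<^const>\<open>rirreducible\<close> trees: they are separated by the
  vertices of the left spine whose right subtree is a leaf.\<close>

fun letters :: "pbt \<Rightarrow> nat" where
  "letters Leaf = 1"
| "letters (Node l u r) = letters l + (if r = Leaf then 1 else 0)"

lemma letters_pos: "letters t \<ge> 1"
  by (induction t) auto

lemma letters_over: "letters (over a b) = letters a + letters b"
  by (induction b) auto

text \<open>The lowest vertex of the left spine with a leaf on its right separates the first
  factor.\<close>

lemma letters_decompose: "letters t > 1 \<Longrightarrow> \<exists>a b. t = over a b \<and> letters a = 1"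
proof (induction t)
  case (Node l u r)
  show ?case
  proof (cases "letters l = 1")
    case True
    then have "r = Leaf" using Node.prems by (auto split: if_splits)
    then have "Node l u r = over l Leaf" by simp
    then show ?thesis using True by blast
  next
    case False
    then have "letters l > 1" using letters_pos[of l] by linarith
    then obtain a b where "l = over a b" "letters a = 1" using Node by blast
    then have "Node l u r = over a (Node b u r)" by simp
    then show ?thesis using \<open>letters a = 1\<close> by blast
  qed
qed simp

lemma rirreducible_iff: "rirreducible t \<longleftrightarrow> letters t = 1"
proof -
  have "letters t \<noteq> 1" if "t = over u w" for u w
    using that letters_over[of u w] letters_pos[of u] letters_pos[of w] by simp
  moreover have "\<exists>u w. t = over u w" if "letters t \<noteq> 1"
  proof -
    have "letters t > 1" using that letters_pos[of t] by linarith
    then show ?thesis using letters_decompose by metis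
  qed
  ultimately show ?thesis
    unfolding rirreducible_def rprod_eq_over by blast
qed

text \<open>Unless the new vertex goes to the bottom of the spine, its right subtree is no leaf, so
  it separates nothing; below it the spine is that of the irreducible \<open>a\<close>.\<close>

lemma letters_spine_inserts:
  "w \<in> spine_inserts a b \<Longrightarrow> letters a = 1 \<Longrightarrow> w \<noteq> over a b \<Longrightarrow> letters w \<le> letters b"
proof (induction b arbitrary: w)
  case (Node l u r)
  show ?case
  proof (cases "w = Node a () (Node l u r)")
    case True
    then show ?thesis using Node.prems letters_pos[of l] by simp
  next
    case False
    then obtain x where x: "w = Node x u r" "x \<in> spine_inserts a l" using Node.prems by auto
    then show ?thesis using Node.IH(1)[of x] Node.prems by auto
  qed
qed simp


section \<open>Moebius inversion\<close>

text \<open>The form of Moebius inversion used below: identities between the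
  \<open>M_colored\<close> are checked after summation over down-sets, where
  \<open>sum_M_colored\<close> produces basis trees.\<close>

lemma sum_down_inject:
  fixes F G :: "pbt \<Rightarrow> 'v::ab_group_add"
  assumes "\<And>t. size t = n \<Longrightarrow> sum F (down t) = sum G (down t)" "size t = n"
  shows "F t = G t"
  using assms(2)
proof (induction "card (down t)" arbitrary: t rule: less_induct)
  case less
  have "F u = G u" if "u \<in> down t - {t}" for u
  proof (rule less.hyps)
    have "down u \<subseteq> down t" using that by (auto intro: tamari_le.trans)
    moreover have "t \<notin> down u" "t \<in> down t"
      using that tamari_antisym by (auto intro: tamari_le.refl)
    ultimately have "down u \<subset> down t" by blast
    then show "card (down u) < card (down t)" by (simp add: psubset_card_mono finite_tamari_below)
    show "size u = n" using that less.prems by (auto dest: tamari_size)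
  qed
  then have "sum F (down t - {t}) = sum G (down t - {t})" by (intro sum.cong) auto
  moreover have "sum H (down t) = H t + sum H (down t - {t})" for H :: "pbt \<Rightarrow> 'v"
    by (rule sum.remove) (auto simp: finite_tamari_below tamari_le.refl)
  ultimately show ?case using assms(1)[OF less.prems] by simp
qed

lemma sum_down_inject2:
  fixes F G :: "pbt \<Rightarrow> pbt \<Rightarrow> 'v::ab_group_add"
  assumes "\<And>a b. size a = m \<Longrightarrow> size b = n \<Longrightarrow>
      (\<Sum>a'\<in>down a. \<Sum>b'\<in>down b. F a' b') = (\<Sum>a'\<in>down a. \<Sum>b'\<in>down b. G a' b')"
    and "size a = m" "size b = n"
  shows "F a b = G a b"
proof -
  have "(\<Sum>b'\<in>down b. F a b') = (\<Sum>b'\<in>down b. G a b')" if "size b = n" for b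
    by (rule sum_down_inject[of m "\<lambda>a. \<Sum>b'\<in>down b. F a b'"]) (auto intro: assms that)
  then show ?thesis by (rule sum_down_inject) (auto intro: assms)
qed

lemma sum_tamari_mu:
  assumes "tamari_le w t"
  shows "(\<Sum>u | tamari_le w u \<and> tamari_le u t. tamari_mu w u) = (if w = t then 1 else 0)"
proof (cases "w = t")
  case True
  then have "{u. tamari_le w u \<and> tamari_le u t} = {t}"
    using tamari_antisym by (auto intro: tamari_le.refl)
  then show ?thesis using True by (simp add: tamari_mu.simps)
next
  case False
  have fin: "finite {u. tamari_le w u \<and> tamari_le u t}"
    by (rule finite_subset[OF _ finite_tamari_below[of t]]) auto
  have "{u. tamari_le w u \<and> tamari_le u t} - {t} = {u. tamari_le w u \<and> tamari_le u t \<and> u \<noteq> t}"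
    by auto
  then have "(\<Sum>u | tamari_le w u \<and> tamari_le u t. tamari_mu w u)
      = tamari_mu w t + (\<Sum>u | tamari_le w u \<and> tamari_le u t \<and> u \<noteq> t. tamari_mu w u)"
    using sum.remove[OF fin, of t] assms by (simp add: tamari_le.refl)
  also have "tamari_mu w t = - (\<Sum>u | tamari_le w u \<and> tamari_le u t \<and> u \<noteq> t. tamari_mu w u)"
    using False assms by (subst tamari_mu.simps) simp
  finally show ?thesis using False by simp
qed

lemma pscale_sum_of_int:
  "finite A \<Longrightarrow> pscale (of_int (sum f A)) x = (\<Sum>a\<in>A. pscale (of_int (f a)) x)"
  by (induction A rule: finite_induct) (simp_all add: pvs.scale_left_distrib)

text \<open>Exchanging the sums leaves, for each \<open>w\<close>, the sum of
  \<open>tamari_mu w\<close> over the interval from \<open>w\<close> to \<open>t\<close>.\<close>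

lemma sum_M_colored: "(\<Sum>u\<in>down t. M_colored u cs) = (basis (colored t cs) :: 's tree \<Rightarrow>\<^sub>0 'k::field)"
proof -
  let ?B = "\<lambda>w. basis (colored w cs) :: 's tree \<Rightarrow>\<^sub>0 'k"
  let ?m = "\<lambda>w u. of_int (tamari_mu w u) :: 'k"
  have "(\<Sum>u\<in>down t. M_colored u cs)
      = (\<Sum>u\<in>down t. \<Sum>w | w \<in> down t \<and> tamari_le w u. pscale (?m w u) (?B w))"
    unfolding M_colored_def by (intro sum.cong refl) (auto intro: tamari_le.trans)
  also have "\<dots> = (\<Sum>w\<in>down t. \<Sum>u | u \<in> down t \<and> tamari_le w u. pscale (?m w u) (?B w))"
    by (rule sum.swap_restrict) (simp_all add: finite_tamari_below)
  also have "\<dots> = (\<Sum>w\<in>down t. if w = t then ?B w else 0)"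
  proof (rule sum.cong)
    fix w assume w: "w \<in> down t"
    have "{u. u \<in> down t \<and> tamari_le w u} = {u. tamari_le w u \<and> tamari_le u t}" by auto
    moreover have "finite {u. tamari_le w u \<and> tamari_le u t}"
      by (rule finite_subset[OF _ finite_tamari_below[of t]]) auto
    ultimately have "(\<Sum>u | u \<in> down t \<and> tamari_le w u. pscale (?m w u) (?B w))
        = pscale (of_int (\<Sum>u | tamari_le w u \<and> tamari_le u t. tamari_mu w u)) (?B w)"
      by (simp add: pscale_sum_of_int del: of_int_sum)
    then show "(\<Sum>u | u \<in> down t \<and> tamari_le w u. pscale (?m w u) (?B w)) = (if w = t then ?B w else 0)"
      using w by (simp add: sum_tamari_mu del: of_int_sum)
  qed simp
  also have "\<dots> = ?B t" by (simp add: sum.delta finite_tamari_below tamari_le.refl)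
  finally show ?thesis .
qed

lemma colored_Node:
  "length cs = size a \<Longrightarrow> colored (Node a () b) (cs @ s # ds) = Node (colored a cs) s (colored b ds)"
  by (simp add: nth_append)

lemma colored_over:
  "length cs = size a \<Longrightarrow> colored (over a b) (cs @ s # ds) = rp (colored a cs) s (colored b ds)"
  by (induction b arbitrary: ds) (auto simp: Suc_diff_le nth_append)

text \<open>Dropping \<open>Suc (size p)\<close> colors skips that of the cut vertex, which belongs
  to neither part.\<close>

lemma cutsum_colored:
  "length cs = size t \<Longrightarrow> cutsum (colored t cs) h
     = cutsum t (\<lambda>p q. h (colored p (take (size p) cs)) (colored q (drop (Suc (size p)) cs)))"
proof (induction t arbitrary: cs h)
  case (Node l u r)
  have "cutsum l (\<lambda>p q. h (colored p (take (size p) (take (size l) cs)))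
          (Node (colored q (drop (Suc (size p)) (take (size l) cs))) (cs ! size l)
            (colored r (drop (Suc (size l)) cs))))
      = cutsum l (\<lambda>p q. h (colored p (take (size p) cs))
          (colored (Node q () r) (drop (Suc (size p)) cs)))"
  proof (rule cutsum_cong)
    fix p q assume "(p, q) \<in> set (cuts l)"
    from size_cuts[OF this] have "size l = Suc (size p + size q)" by simp
    then show "h (colored p (take (size p) (take (size l) cs)))
          (Node (colored q (drop (Suc (size p)) (take (size l) cs))) (cs ! size l)
            (colored r (drop (Suc (size l)) cs)))
        = h (colored p (take (size p) cs)) (colored (Node q () r) (drop (Suc (size p)) cs))"
      using Node.prems by (simp add: drop_take add.commute)
  qed simp
  moreover have "cutsum r (\<lambda>p q. h (Node (colored l (take (size l) cs)) (cs ! size l)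
            (colored p (take (size p) (drop (Suc (size l)) cs))))
          (colored q (drop (Suc (size p)) (drop (Suc (size l)) cs))))
      = cutsum r (\<lambda>p q. h (colored (Node l () p) (take (size (Node l () p)) cs))
          (colored q (drop (Suc (size (Node l () p))) cs)))"
    by (simp add: drop_take add.commute)
  ultimately show ?case using Node by simp
qed simp

lemma bilin_ext_sum_sum:
  "bilin_ext f (sum u A) (sum v B) = (\<Sum>a\<in>A. \<Sum>b\<in>B. bilin_ext f (u a) (v b))"
  unfolding bilin_ext_sum_left unfolding bilin_ext_sum_right ..

text \<open>After summation over \<open>down a\<close> and \<open>down b\<close> both sides are the
  same basis tree, since \<open>over\<close> maps the product of these down-sets bijectively onto
  \<open>down (over a b)\<close>.\<close>

lemma M_colored_over:
  assumes "length cs = size a" "length ds = size b"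
  shows "M_colored (over a b) (cs @ s # ds) = RP s (M_colored a cs) (M_colored b ds)"
proof (rule sum_down_inject2)
  fix a b :: pbt
  assume ab: "size a = length cs" "size b = length ds"
  have inj: "inj_on (\<lambda>(a', b'). over a' b') (down a \<times> down b)"
    by (rule inj_onI) (auto dest!: rp_inject tamari_size)
  have "(\<Sum>a'\<in>down a. \<Sum>b'\<in>down b. M_colored (over a' b') (cs @ s # ds))
      = (\<Sum>w\<in>down (over a b). M_colored w (cs @ s # ds))"
    unfolding down_over sum.reindex[OF inj]
    by (simp add: sum.cartesian_product case_prod_unfold)
  also have "\<dots> = RP s (basis (colored a cs)) (basis (colored b ds))"
    using ab by (simp add: sum_M_colored colored_over)
  also have "\<dots> = (\<Sum>a'\<in>down a. \<Sum>b'\<in>down b. RP s (M_colored a' cs) (M_colored b' ds))"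
    by (simp add: RP_def bilin_ext_sum_sum flip: sum_M_colored)
  finally show "(\<Sum>a'\<in>down a. \<Sum>b'\<in>down b. M_colored (over a' b') (cs @ s # ds))
      = (\<Sum>a'\<in>down a. \<Sum>b'\<in>down b. RP s (M_colored a' cs) (M_colored b' ds))" .
qed (simp_all add: assms)

definition JP :: "'s \<Rightarrow> ('s tree \<Rightarrow>\<^sub>0 'k::field) \<Rightarrow> ('s tree \<Rightarrow>\<^sub>0 'k) \<Rightarrow> ('s tree \<Rightarrow>\<^sub>0 'k)" where
  "JP s = bilin_ext (\<lambda>a b. basis (Node a s b))"

text \<open>The sets of spine insertions partition \<open>down (Node a () b)\<close>: a tree in one
  of them recovers its pair as a cut whose left part has known size.\<close>

lemma JP_M_colored:
  assumes "length cs = size a" "length ds = size b"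
  shows "JP s (M_colored a cs) (M_colored b ds)
    = (\<Sum>w\<in>spine_inserts a b. M_colored w (cs @ s # ds))"
proof (rule sum_down_inject2)
  fix a b :: pbt
  assume ab: "size a = length cs" "size b = length ds"
  let ?S = "\<lambda>(a', b'). spine_inserts a' b'"
  have disj: "?S x \<inter> ?S y = {}" if "x \<in> down a \<times> down b" "y \<in> down a \<times> down b" "x \<noteq> y" for x y
  proof (rule ccontr)
    assume "?S x \<inter> ?S y \<noteq> {}"
    then obtain w where "w \<in> ?S x" "w \<in> ?S y" by blast
    then have "(fst x, snd x) \<in> set (cuts w)" "(fst y, snd y) \<in> set (cuts w)"
      by (auto simp: case_prod_unfold dest: cut_spine_inserts)
    moreover have "tamari_le (fst x) a" "tamari_le (fst y) a" using that by auto
    then have "size (fst x) = size (fst y)" using tamari_size by metis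
    ultimately show False using that(3) cuts_unique by (metis prod_eqI)
  qed
  have "(\<Sum>a'\<in>down a. \<Sum>b'\<in>down b. \<Sum>w\<in>spine_inserts a' b'. M_colored w (cs @ s # ds))
      = (\<Sum>x\<in>down a \<times> down b. \<Sum>w\<in>?S x. M_colored w (cs @ s # ds))"
    by (simp add: sum.cartesian_product case_prod_unfold)
  also have "\<dots> = (\<Sum>w\<in>down (Node a () b). M_colored w (cs @ s # ds))"
    unfolding down_Node
    by (rule sum.UNION_disjoint[symmetric])
      (use disj in \<open>simp_all add: finite_tamari_below finite_spine_inserts case_prod_unfold\<close>)
  also have "\<dots> = JP s (basis (colored a cs)) (basis (colored b ds))"
    using ab by (simp add: sum_M_colored JP_def del: colored.simps add: colored_Node)
  also have "\<dots> = (\<Sum>a'\<in>down a. \<Sum>b'\<in>down b. JP s (M_colored a' cs) (M_colored b' ds))"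
    by (simp add: JP_def bilin_ext_sum_sum flip: sum_M_colored)
  finally show "(\<Sum>a'\<in>down a. \<Sum>b'\<in>down b. JP s (M_colored a' cs) (M_colored b' ds))
      = (\<Sum>a'\<in>down a. \<Sum>b'\<in>down b. \<Sum>w\<in>spine_inserts a' b'. M_colored w (cs @ s # ds))" ..
qed (simp_all add: assms)

lemma rcoprod_sum: "rcoprod (sum f A) = (\<Sum>a\<in>A. rcoprod (f a))"
  by (simp add: rcoprod_def lin_ext_sum)

text \<open>Since \<open>over a b \<le> t\<close> in the Tamari order iff \<open>t\<close> has a cut above \<open>(a, b)\<close>, Moebius inversion turns the
  reduced coproduct of \<open>M\<^sub>t\<close> into the sum of \<open>M\<^sub>a \<otimes> M\<^sub>b\<close> over the factorizations of \<open>t\<close> as \<^term>\<open>over a b\<close>.\<close>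

lemma rcoprod_M_colored:
  fixes cs :: "'s list"
  assumes "length cs = size t"
  shows "rcoprod (M_colored t cs) = (\<Sum>(a, b) | over a b = t.
    tensor (M_colored a (take (size a) cs)) (M_colored b (drop (Suc (size a)) cs) :: 's tree \<Rightarrow>\<^sub>0 'k::field))"
proof (rule sum_down_inject)
  fix t :: pbt
  assume t: "size t = length cs"
  let ?M = "\<lambda>(a, b). tensor (M_colored a (take (size a) cs))
      (M_colored b (drop (Suc (size a)) cs) :: 's tree \<Rightarrow>\<^sub>0 'k)"
  let ?O = "\<lambda>t. {(a, b). over a b = t}"
  have fin: "finite (?O u)" for u
  proof (rule finite_subset)
    show "?O u \<subseteq> set (cuts u)" using cut_over by auto
  qed simp
  have "(\<Sum>u\<in>down t. \<Sum>x\<in>?O u. ?M x) = (\<Sum>x\<in>(\<Union>u\<in>down t. ?O u). ?M x)"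
    by (subst sum.UNION_disjoint) (auto simp: finite_tamari_below fin)
  \<comment> \<open>By \<open>over_le_iff\<close> the tree \<open>over a b\<close> lies below
    \<open>t\<close> iff some cut of \<open>t\<close> lies above \<open>(a, b)\<close>. That cut is
    unique, its left part having the size of \<open>a\<close>.\<close>
  also have "(\<Union>u\<in>down t. ?O u) = (\<Union>x\<in>set (cuts t). down (fst x) \<times> down (snd x))"
    by (fastforce simp: over_le_iff Bex_def)
  also have "(\<Sum>x\<in>\<dots>. ?M x) = (\<Sum>y\<in>set (cuts t). \<Sum>x\<in>down (fst y) \<times> down (snd y). ?M x)"
  proof (rule sum.UNION_disjoint)
    show "\<forall>i\<in>set (cuts t). \<forall>j\<in>set (cuts t). i \<noteq> j \<longrightarrow>
        down (fst i) \<times> down (snd i) \<inter> down (fst j) \<times> down (snd j) = {}"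
    proof (intro ballI impI, rule ccontr)
      fix i j
      assume i: "i \<in> set (cuts t)" and j: "j \<in> set (cuts t)" and "i \<noteq> j"
        and "down (fst i) \<times> down (snd i) \<inter> down (fst j) \<times> down (snd j) \<noteq> {}"
      then obtain a where "tamari_le a (fst i)" "tamari_le a (fst j)" by auto
      then have "size (fst i) = size (fst j)" using tamari_size by metis
      then show False
        using cuts_unique i j \<open>i \<noteq> j\<close> by (metis prod.collapse)
    qed
  qed (auto simp: finite_tamari_below)
  also have "\<dots> = cutsum t (\<lambda>p q. \<Sum>x\<in>down p \<times> down q. ?M x)"
    by (simp add: cutsum_eq_sum case_prod_unfold)
  also have "\<dots> = cutsum t (\<lambda>p q. tensor (basis (colored p (take (size p) cs)))
      (basis (colored q (drop (Suc (size p)) cs))))"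
  proof (rule cutsum_cong)
    fix p q
    have "(\<Sum>x\<in>down p \<times> down q. ?M x) = (\<Sum>a\<in>down p. \<Sum>b\<in>down q.
        tensor (M_colored a (take (size p) cs)) (M_colored b (drop (Suc (size p)) cs)))"
      unfolding sum.cartesian_product by (intro sum.cong) (auto dest: tamari_size)
    also have "\<dots> = tensor (basis (colored p (take (size p) cs))) (basis (colored q (drop (Suc (size p)) cs)))"
      by (simp add: tensor_def bilin_ext_sum_sum flip: sum_M_colored)
    finally show "(\<Sum>x\<in>down p \<times> down q. ?M x)
        = tensor (basis (colored p (take (size p) cs))) (basis (colored q (drop (Suc (size p)) cs)))" .
  qed simp
  also have "\<dots> = rcoprod (basis (colored t cs))"
    using t by (simp add: cutsum_colored tensor_def)
  also have "\<dots> = (\<Sum>u\<in>down t. rcoprod (M_colored u cs))"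
    by (simp add: rcoprod_sum flip: sum_M_colored)
  finally show "(\<Sum>u\<in>down t. rcoprod (M_colored u cs)) = (\<Sum>u\<in>down t. \<Sum>x\<in>?O u. ?M x)" ..
qed (simp add: assms)

lemma rcoprod_M_colored_irreducible:
  assumes "length cs = size t" "rirreducible t"
  shows "rcoprod (M_colored t cs) = 0"
proof -
  have "{(a, b). over a b = t} = {}"
    using assms(2) by (auto simp: rirreducible_def rprod_eq_over)
  then show ?thesis by (simp only: rcoprod_M_colored[OF assms(1)] sum.empty)
qed


section \<open>Grafting of primitive elements\<close>

text \<open>The value at a missing leaf matters in \<open>rcoprod_graft_lin\<close>, where trees in
  \<open>x\<close> may have fewer than \<open>j\<close> leaves.\<close>

lemma graft_beyond: "size1 t < j \<Longrightarrow> graft t j w = t"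
  by (induction t arbitrary: j) auto

lemma size1_pos: "size1 t \<ge> 1"
  by (induction t) auto

lemma size1_cuts: "(p, q) \<in> set (cuts t) \<Longrightarrow> size1 p + size1 q = size1 t"
  using size_cuts[of p q t] by (simp add: size1_size)

text \<open>At a vertex of \<open>t\<close>, the tree \<open>w\<close> stays with the part that
  holds leaf \<open>j\<close>. At a vertex of \<open>w\<close>, the maps \<open>u\<close> and
  \<open>v\<close> attach what lies left and right of that leaf; they do not depend on
  \<open>w\<close>, so the second sum vanishes on primitive elements.\<close>

lemma cutsum_graft:
  assumes "1 \<le> j" "j \<le> size1 t"
  obtains u v where "\<And>w (h :: _ \<Rightarrow> _ \<Rightarrow> 'v::ab_group_add). cutsum (graft t j w) h =
    cutsum t (\<lambda>p q. if size1 p < j then h p (graft q (j - size1 p) w) else h (graft p j w) q)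
    + cutsum w (\<lambda>p q. h (u p) (v q))"
  using assms
proof (induction t arbitrary: j thesis)
  case Leaf
  then show ?case using Leaf(1)[of "\<lambda>p. p" "\<lambda>q. q"] by simp
next
  case (Node l s r)
  show ?case
  proof (cases "j \<le> size1 l")
    case True
    obtain u v where uv: "\<And>w (h :: _ \<Rightarrow> _ \<Rightarrow> 'v). cutsum (graft l j w) h =
        cutsum l (\<lambda>p q. if size1 p < j then h p (graft q (j - size1 p) w) else h (graft p j w) q)
        + cutsum w (\<lambda>p q. h (u p) (v q))"
      using Node.IH(1) True Node.prems(2) by blast
    show ?thesis
    proof (rule Node.prems(1)[of u "\<lambda>q. Node (v q) s r"])
      fix w and h :: "_ \<Rightarrow> _ \<Rightarrow> 'v"
      have "cutsum l (\<lambda>p q. if size1 p < j then h p (graft (Node q s r) (j - size1 p) w)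
            else h (graft p j w) (Node q s r))
          = cutsum l (\<lambda>p q. if size1 p < j then h p (Node (graft q (j - size1 p) w) s r)
            else h (graft p j w) (Node q s r))"
        using True by (intro cutsum_cong) (auto dest!: size1_cuts)
      moreover have "cutsum r (\<lambda>p q. if size1 (Node l s p) < j
            then h (Node l s p) (graft q (j - size1 (Node l s p)) w) else h (graft (Node l s p) j w) q)
          = cutsum r (\<lambda>p q. h (Node (graft l j w) s p) q)"
        using True by (intro cutsum_cong) auto
      moreover have "graft (Node l s r) j w = Node (graft l j w) s r" using True by simp
      ultimately show "cutsum (graft (Node l s r) j w) h = cutsum (Node l s r)
          (\<lambda>p q. if size1 p < j then h p (graft q (j - size1 p) w) else h (graft p j w) q)
          + cutsum w (\<lambda>p q. h (u p) (Node (v q) s r))"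
        using True by (simp only: cutsum_Node uv) (simp add: add_ac)
    qed
  next
    case False
    obtain u v where uv: "\<And>w (h :: _ \<Rightarrow> _ \<Rightarrow> 'v). cutsum (graft r (j - size1 l) w) h =
        cutsum r (\<lambda>p q. if size1 p < j - size1 l then h p (graft q (j - size1 l - size1 p) w)
          else h (graft p (j - size1 l) w) q)
        + cutsum w (\<lambda>p q. h (u p) (v q))"
    proof -
      have "1 \<le> j - size1 l" "j - size1 l \<le> size1 r" using False Node.prems(3) by auto
      then show thesis using Node.IH(2) that by blast
    qed
    show ?thesis
    proof (rule Node.prems(1)[of "\<lambda>p. Node l s (u p)" v])
      fix w and h :: "_ \<Rightarrow> _ \<Rightarrow> 'v"
      have "cutsum l (\<lambda>p q. if size1 p < j then h p (graft (Node q s r) (j - size1 p) w)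
            else h (graft p j w) (Node q s r))
          = cutsum l (\<lambda>p q. h p (Node q s (graft r (j - size1 l) w)))"
      proof (rule cutsum_cong)
        fix p q assume "(p, q) \<in> set (cuts l)"
        from size1_cuts[OF this] have "size1 l = size1 p + size1 q" by simp
        then show "(if size1 p < j then h p (graft (Node q s r) (j - size1 p) w)
              else h (graft p j w) (Node q s r)) = h p (Node q s (graft r (j - size1 l) w))"
          using False by auto
      qed simp
      moreover have "cutsum r (\<lambda>p q. if size1 (Node l s p) < j then h (Node l s p) (graft q (j - size1 (Node l s p)) w)
            else h (graft (Node l s p) j w) q)
          = cutsum r (\<lambda>p q. if size1 p < j - size1 l then h (Node l s p) (graft q (j - size1 l - size1 p) w)
          else h (Node l s (graft p (j - size1 l) w)) q)"
        using False by (intro cutsum_cong) auto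
      moreover have "graft (Node l s r) j w = Node l s (graft r (j - size1 l) w)" using False by simp
      ultimately show "cutsum (graft (Node l s r) j w) h = cutsum (Node l s r)
          (\<lambda>p q. if size1 p < j then h p (graft q (j - size1 p) w) else h (graft p j w) q)
          + cutsum w (\<lambda>p q. h (Node l s (u p)) (v q))"
        using False by (simp only: cutsum_Node uv) (simp add: add_ac)
    qed
  qed
qed

text \<open>Cuts at vertices of the grafted trees cancel because \<open>y\<close> is primitive, then
  those at vertices of the host trees because \<open>x\<close> is.\<close>

lemma rcoprod_graft_lin:
  fixes x y :: "'s tree \<Rightarrow>\<^sub>0 'k::field"
  assumes "rcoprod x = 0" "rcoprod y = 0" "1 \<le> j"
  shows "rcoprod (graft_lin x j y) = 0"
proof -
  let ?h = "\<lambda>w p q. if size1 p < j then basis (p, graft q (j - size1 p) w)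
      else basis (graft p j w, q) :: 's tree \<times> 's tree \<Rightarrow>\<^sub>0 'k"
  have "lin_ext (\<lambda>w. rcoprod (basis (graft t j w))) y = lin_ext (\<lambda>w. cutsum t (?h w)) y" for t
  proof (cases "j \<le> size1 t")
    case True
    then obtain u v where uv: "\<And>w (h :: _ \<Rightarrow> _ \<Rightarrow> 's tree \<times> 's tree \<Rightarrow>\<^sub>0 'k). cutsum (graft t j w) h =
        cutsum t (\<lambda>p q. if size1 p < j then h p (graft q (j - size1 p) w) else h (graft p j w) q)
        + cutsum w (\<lambda>p q. h (u p) (v q))"
      using cutsum_graft[OF assms(3) True] by blast
    show ?thesis
      by (simp add: uv lin_ext_fun_add lin_ext_cutsum_primitive[OF assms(2)])
  next
    case False
    \<comment> \<open>Leaf \<open>j\<close> is missing in \<open>t\<close>, and correspondingly in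
      the right part of each cut.\<close>
    have "cutsum t (?h w) = cutsum t (\<lambda>p q. basis (p, q))" for w
    proof (rule cutsum_cong)
      fix p q assume "(p, q) \<in> set (cuts t)"
      then have "size1 p < j" "size1 q < j - size1 p"
        using False size1_cuts[of p q t] size1_pos[of q] by auto
      then show "?h w p q = basis (p, q)" by (simp add: graft_beyond)
    qed simp
    then show ?thesis using False by (simp add: graft_beyond)
  qed
  then have "rcoprod (graft_lin x j y) = lin_ext (\<lambda>t. lin_ext (\<lambda>w. cutsum t (?h w)) y) x"
    by (simp add: graft_lin_def bilin_ext_def rcoprod_lin_ext)
  also have "\<dots> = lin_ext (\<lambda>w. lin_ext (\<lambda>t. cutsum t (?h w)) x) y"
    by (rule lin_ext_swap)
  finally show ?thesis by (simp add: lin_ext_cutsum_primitive[OF assms(1)])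
qed

lemma rcoprod_graft_all:
  assumes "rcoprod x = 0" "\<And>w. w \<in> set ws \<Longrightarrow> rcoprod w = 0"
  shows "rcoprod (graft_all x ws) = 0"
proof -
  have fold: "rcoprod (foldr (\<lambda>(j, w) y. graft_lin y j w) zs x) = 0"
    if "\<And>j w. (j, w) \<in> set zs \<Longrightarrow> 1 \<le> j \<and> rcoprod w = 0" for zs
    using that assms(1) by (induction zs) (fastforce intro!: rcoprod_graft_lin)+
  show ?thesis
    unfolding graft_all_def
  proof (rule fold)
    fix j w assume "(j, w) \<in> set (zip [1..<Suc (length ws)] ws)"
    from set_zip_leftD[OF this] set_zip_rightD[OF this] show "1 \<le> j \<and> rcoprod w = 0"
      using assms(2) by (simp del: upt_Suc)
  qed
qed

lemma rcoprod_I_graded: "(n, x) \<in> I_graded sb \<Longrightarrow> rcoprod x = 0"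
proof (induction rule: I_graded.induct)
  \<comment> \<open>The two cherries have the same cut, as the color of the cut vertex is
    forgotten.\<close>
  case (two s)
  then show ?case by (simp add: cherry_def hat_def rcoprod_def)
next
  case (irr n t cs)
  then show ?case by (intro rcoprod_M_colored_irreducible) (auto simp: size1_size)
next
  case (comp n r x ws ms)
  then show ?case
    by (intro rcoprod_graft_all) (auto simp: list_all2_conv_all_nth in_set_conv_nth)
qed simp


section \<open>Generation of the primitive elements\<close>

definition I_all :: "'s \<Rightarrow> ('s tree \<Rightarrow>\<^sub>0 'k::field) set" where
  "I_all sb = {x. \<exists>n. (n, x) \<in> I_graded sb}"

lemma KI_eq_span: "KI sb = (pvs.span (I_all sb) :: ('s tree \<Rightarrow>\<^sub>0 'k::field) set)"
proof
  have "I_set sb n \<subseteq> (I_all sb :: ('s tree \<Rightarrow>\<^sub>0 'k) set)" for n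
    by (auto simp: I_set_def I_all_def)
  then have "(\<Union>n\<in>{1..}. pvs.span (I_set sb n)) \<subseteq> (pvs.span (I_all sb) :: ('s tree \<Rightarrow>\<^sub>0 'k) set)"
    by (meson UN_least pvs.span_mono)
  then show "KI sb \<subseteq> (pvs.span (I_all sb) :: ('s tree \<Rightarrow>\<^sub>0 'k) set)"
    unfolding KI_def by (rule pvs.span_minimal) (rule pvs.subspace_span)
next
  show "pvs.span (I_all sb) \<subseteq> (KI sb :: ('s tree \<Rightarrow>\<^sub>0 'k) set)"
    unfolding KI_def
  proof (rule pvs.span_mono, rule subsetI)
    fix x :: "'s tree \<Rightarrow>\<^sub>0 'k"
    assume "x \<in> I_all sb"
    then obtain n where n: "(n, x) \<in> I_graded sb" by (auto simp: I_all_def)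
    then have "n \<ge> 1" by (cases rule: I_graded.cases) auto
    moreover have "x \<in> pvs.span (I_set sb n)" using n by (auto simp: I_set_def intro: pvs.span_base)
    ultimately show "x \<in> (\<Union>n\<in>{1..}. pvs.span (I_set sb n))" by auto
  qed
qed

lemma subspace_KI: "pvs.subspace (KI sb)"
  by (simp add: KI_eq_span)

lemma rcoprod_KI:
  assumes "x \<in> KI sb"
  shows "rcoprod x = 0"
proof -
  have "lin_ext (\<lambda>t. cutsum t (\<lambda>p q. basis (p, q))) x \<in> {0}"
    using assms unfolding KI_eq_span
    by (rule lin_ext_span) (auto simp: I_all_def rcoprod_I_graded simp flip: rcoprod_def)
  then show ?thesis by (simp add: rcoprod_def)
qed

text \<open>The purpose of the generators in degree two: grafting onto them is a join along
  \<open>s\<close> minus the join along \<open>sb\<close>.\<close>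

lemma graft_all_cherry:
  "graft_all (cherry (hat sb s)) [x, y] = JP s x y - JP sb x y"
proof -
  \<comment> \<open>The fold grafts from right to left, so \<open>y\<close> is placed first and leaf
    1 keeps its number.\<close>
  have "graft_lin (graft_lin (basis (Node Leaf u Leaf)) 2 y) 1 x = JP u x y" for u
    by (simp add: graft_lin_def JP_def bilin_ext_def lin_ext_comp) (rule lin_ext_swap)
  moreover have "graft_lin (a - b) j w = graft_lin a j w - graft_lin b j w" for a b and w :: "'a tree \<Rightarrow>\<^sub>0 'b" and j
    by (simp add: graft_lin_def bilin_ext_diff_left)
  moreover have "zip [1..<Suc (length [x, y])] [x, y] = [(1, x), (2, y)]"
    by (simp add: upt_rec)
  ultimately show ?thesis
    by (simp add: graft_all_def cherry_def hat_def del: upt_Suc)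
qed

lemma JP_diff_KI:
  fixes x y :: "'s tree \<Rightarrow>\<^sub>0 'k::field"
  assumes "x \<in> KI sb" "y \<in> KI sb"
  shows "JP s x y - JP sb x y \<in> KI sb"
proof -
  let ?f = "\<lambda>a b. basis (Node a s b) - basis (Node a sb b) :: 's tree \<Rightarrow>\<^sub>0 'k"
  have eq: "bilin_ext ?f x y = JP s x y - JP sb x y" for x y
    by (simp add: JP_def bilin_ext_def lin_ext_fun_diff)
  have "bilin_ext ?f x y \<in> KI sb" if "x \<in> I_all sb" "y \<in> I_all sb" for x y
  proof (cases "s = sb")
    case True
    then show ?thesis unfolding eq by (simp add: pvs.subspace_0[OF subspace_KI])
  next
    case False
    obtain m n where mn: "(m, x) \<in> I_graded sb" "(n, y) \<in> I_graded sb"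
      using \<open>x \<in> I_all sb\<close> \<open>y \<in> I_all sb\<close> by (auto simp: I_all_def)
    have pos: "k \<ge> 1" and one: "k = 1 \<longrightarrow> z = basis Leaf"
      if "(k, z) \<in> I_graded sb" for k and z :: "'s tree \<Rightarrow>\<^sub>0 'k"
      using that by (cases rule: I_graded.cases; simp)+
    have h: "(2, cherry (hat sb s)) \<in> (I_graded sb :: (nat \<times> ('s tree \<Rightarrow>\<^sub>0 'k)) set)"
      using False by (rule I_graded.two)
    have "(m + n, JP s x y - JP sb x y) \<in> I_graded sb"
    proof (cases "m + n > 2")
      case True
      have "(m + n, graft_all (cherry (hat sb s)) [x, y]) \<in> I_graded sb"
        by (rule I_graded.comp[OF True h, where ms = "[m, n]"])
          (use True pos[OF mn(1)] pos[OF mn(2)] mn in auto)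
      then show ?thesis by (simp only: graft_all_cherry)
    next
      case False
      then have mn1: "m = 1" "n = 1" using pos[OF mn(1)] pos[OF mn(2)] by auto
      then have "x = basis Leaf" "y = basis Leaf" using one mn by blast+
      then have "JP s x y - JP sb x y = cherry (hat sb s)"
        by (simp add: JP_def cherry_def hat_def)
      then show ?thesis using h mn1 by (simp add: numeral_2_eq_2)
    qed
    then have "JP s x y - JP sb x y \<in> I_all sb" by (auto simp: I_all_def)
    then show ?thesis unfolding eq KI_eq_span by (rule pvs.span_base)
  qed
  then show ?thesis
    using bilin_ext_span[of x "I_all sb" y "I_all sb" "KI sb" ?f] assms subspace_KI
    by (simp add: KI_eq_span eq)
qed

lemma M_colored_Leaf: "M_colored Leaf cs = basis Leaf"
  by (simp add: M_colored_def tamari_mu.simps)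

lemma M_colored_irreducible_KI:
  fixes sb :: 's
  assumes "letters t = 1" "length cs = size t"
  shows "M_colored t cs \<in> (KI sb :: ('s tree \<Rightarrow>\<^sub>0 'k::field) set)"
proof -
  consider "t = Leaf" | "size t = 1" | "size t \<ge> 2"
    using le_less_linear[of 2 "size t"] by (cases t) force+
  then have "M_colored t cs \<in> (I_all sb :: ('s tree \<Rightarrow>\<^sub>0 'k) set)"
  proof cases
    case 1
    then show ?thesis by (auto simp: I_all_def M_colored_Leaf intro: I_graded.one[unfolded One_nat_def])
  next
    case 2
    \<comment> \<open>The cherry is the product of two leaves and so has two letters, contrary to
      the assumption.\<close>
    then have "t = Node Leaf () Leaf" by (cases t) auto
    then show ?thesis using assms by simp
  next
    case 3
    then have "(size1 t, M_colored t cs :: 's tree \<Rightarrow>\<^sub>0 'k) \<in> I_graded sb"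
      using assms by (intro I_graded.irr) (auto simp: size1_size rirreducible_iff)
    then show ?thesis by (auto simp: I_all_def)
  qed
  then show ?thesis by (simp add: KI_eq_span pvs.span_base)
qed

section \<open>The filtration by the number of irreducible factors\<close>

definition M_filtration :: "nat \<Rightarrow> ('s tree \<Rightarrow>\<^sub>0 'k::field) set" where
  "M_filtration k = {M_colored t cs | t cs. length cs = size t \<and> letters t \<le> k}"

definition decomposables :: "'s \<Rightarrow> nat \<Rightarrow> ('s tree \<Rightarrow>\<^sub>0 'k::field) set" where
  "decomposables sb k = {RP sb (M_colored u cs) (M_colored v ds) | u cs v ds.
     length cs = size u \<and> length ds = size v \<and> letters u + letters v \<le> k}"

lemma M_filtrationI: "length cs = size t \<Longrightarrow> letters t \<le> k \<Longrightarrow> M_colored t cs \<in> M_filtration k"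
  by (auto simp: M_filtration_def)

lemma decomposablesI:
  "length cs = size u \<Longrightarrow> length ds = size v \<Longrightarrow> letters u + letters v \<le> k
    \<Longrightarrow> RP sb (M_colored u cs) (M_colored v ds) \<in> decomposables sb k"
  by (auto simp: decomposables_def)

lemma decomposables_subset: "decomposables sb k \<subseteq> M_filtration k"
proof
  fix x :: "'a tree \<Rightarrow>\<^sub>0 'b"
  assume "x \<in> decomposables sb k"
  then obtain u cs v ds where x: "x = RP sb (M_colored u cs) (M_colored v ds)"
    "length cs = size u" "length ds = size v" "letters u + letters v \<le> k"
    by (auto simp: decomposables_def)
  then have "x = M_colored (over u v) (cs @ sb # ds)" by (simp add: M_colored_over)
  then show "x \<in> M_filtration k" using x by (auto simp: letters_over intro!: M_filtrationI)
qed

lemma decomposables_mono: "k \<le> k' \<Longrightarrow> decomposables sb k \<subseteq> decomposables sb k'"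
proof
  fix x :: "'a tree \<Rightarrow>\<^sub>0 'b"
  assume k: "k \<le> k'" and "x \<in> decomposables sb k"
  then obtain u cs v ds where x: "x = RP sb (M_colored u cs) (M_colored v ds)"
    "length cs = size u" "length ds = size v" "letters u + letters v \<le> k"
    unfolding decomposables_def by blast
  show "x \<in> decomposables sb k'"
    unfolding x(1) using x k by (intro decomposablesI) auto
qed

text \<open>The colored join and the over product of \<open>M\<^sub>a\<close> and \<open>M\<^sub>b\<close> agree up to terms with fewer
  irreducible factors, and a join along \<open>s - s\<^sub>\<bullet>\<close> of elements of \<^const>\<open>KI\<close> is in \<^const>\<open>KI\<close>. So one can trade
  the color \<open>s\<close> of the first separating vertex for \<open>s\<^sub>\<bullet>\<close>.\<close>

lemma M_filtration_subset:
  "M_filtration k \<subseteq> (pvs.span (I_all sb \<union> decomposables sb k) :: ('s tree \<Rightarrow>\<^sub>0 'k::field) set)"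
proof (induction k)
  case 0
  have "M_filtration 0 = ({} :: ('s tree \<Rightarrow>\<^sub>0 'k) set)"
  proof -
    have "letters t \<noteq> 0" for t using letters_pos[of t] by linarith
    then show ?thesis by (auto simp: M_filtration_def)
  qed
  then show ?case by simp
next
  case (Suc k)
  let ?W = "pvs.span (I_all sb \<union> decomposables sb (Suc k)) :: ('s tree \<Rightarrow>\<^sub>0 'k) set"
  have KI_W: "z \<in> ?W" if "z \<in> KI sb" for z
    using that pvs.span_mono[of "I_all sb" "I_all sb \<union> decomposables sb (Suc k)"]
    by (auto simp: KI_eq_span)
  have D_W: "z \<in> ?W" if "z \<in> pvs.span (decomposables sb (Suc k))" for z
    using that pvs.span_mono[of "decomposables sb (Suc k)" "I_all sb \<union> decomposables sb (Suc k)"]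
    by auto
  have F_W: "z \<in> ?W" if "z \<in> pvs.span (M_filtration k)" for z
  proof -
    have "M_filtration k \<subseteq> ?W"
      by (rule order_trans[OF Suc.IH pvs.span_mono[OF Un_mono[OF subset_refl decomposables_mono]]]) simp
    then show ?thesis using that pvs.span_minimal[OF _ pvs.subspace_span] by blast
  qed
  show ?case
  proof
    fix x :: "'s tree \<Rightarrow>\<^sub>0 'k"
    assume "x \<in> M_filtration (Suc k)"
    then obtain t cs where x: "x = M_colored t cs" and cs: "length cs = size t" and t: "letters t \<le> Suc k"
      by (auto simp: M_filtration_def)
    show "x \<in> ?W"
    proof (cases "letters t = 1")
      case True
      then show ?thesis unfolding x by (intro KI_W M_colored_irreducible_KI cs)
    next
      case False
      then have "letters t > 1" using letters_pos[of t] by linarith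
      then obtain a b where ab: "t = over a b" "letters a = 1" using letters_decompose by blast
      then have b: "letters b \<le> k" using t by (simp add: letters_over)
      define c1 s c2 where "c1 = take (size a) cs" and "s = cs ! size a" and "c2 = drop (Suc (size a)) cs"
      have cs_eq: "cs = c1 @ s # c2" and len: "length c1 = size a" "length c2 = size b"
        using cs by (simp_all add: c1_def s_def c2_def ab id_take_nth_drop)
      let ?A = "M_colored a c1 :: 's tree \<Rightarrow>\<^sub>0 'k" and ?B = "M_colored b c2 :: 's tree \<Rightarrow>\<^sub>0 'k"
      have B: "?B \<in> M_filtration k" by (rule M_filtrationI) (simp_all add: len b)
      then have "?B \<in> pvs.span (I_all sb \<union> decomposables sb k)" by (rule subsetD[OF Suc.IH])
      \<comment> \<open>The two summands are treated differently: for \<open>d\<close> associativity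
        is enough, for \<open>y\<close> the color is changed through the join.\<close>
      then obtain y d where B_eq: "?B = y + d" and y: "y \<in> KI sb" and d: "d \<in> pvs.span (decomposables sb k)"
        unfolding pvs.span_Un KI_eq_span by auto
      have "d \<in> pvs.span (M_filtration k)"
        using d by (rule subsetD[OF pvs.span_mono[OF decomposables_subset], rotated])
      \<comment> \<open>Like \<open>?B\<close> and \<open>d\<close>, the element \<open>y\<close>
        involves at most \<open>k\<close> factors; this bounds the correction terms in
        \<open>JR\<close>.\<close>
      then have yF: "y \<in> pvs.span (M_filtration k)"
        using pvs.span_diff[OF pvs.span_base[OF B], of d] B_eq by simp
      \<comment> \<open>A product along any \<open>u\<close> with a product along \<open>sb\<close>
        is, by associativity, again a product along \<open>sb\<close>.\<close>
      have RPd: "RP u ?A d \<in> ?W" for u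
        unfolding RP_def
      proof (rule bilin_ext_span[of ?A "{?A}" d "decomposables sb k"])
        fix a' b' assume a': "a' \<in> {?A}" and b': "b' \<in> (decomposables sb k :: ('s tree \<Rightarrow>\<^sub>0 'k) set)"
        obtain v cv w cw where *: "b' = RP sb (M_colored v cv) (M_colored w cw)"
            "length cv = size v" "length cw = size w" "letters v + letters w \<le> k"
          using b' unfolding decomposables_def by blast
        then have "RP u a' b' = RP sb (M_colored (over a v) (c1 @ u # cv)) (M_colored w cw)"
          using a' by (simp add: RP_assoc M_colored_over len)
        also have "\<dots> \<in> decomposables sb (Suc k)"
          by (rule decomposablesI) (use * ab len in \<open>simp_all add: letters_over\<close>)
        finally have "RP u a' b' \<in> ?W" by (simp add: pvs.span_base)
        then show "bilin_ext (\<lambda>a b. basis (rp a u b)) a' b' \<in> ?W" by (simp add: RP_def)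
      qed (simp_all add: d pvs.span_base)
      \<comment> \<open>The bottom insertion on the spine is the over product; all other insertions
        have at most \<open>k\<close> factors.\<close>
      have JR: "JP u ?A y - RP u ?A y \<in> ?W" for u
      proof -
        let ?g = "\<lambda>a b. basis (Node a u b) - basis (rp a u b) :: 's tree \<Rightarrow>\<^sub>0 'k"
        have eq: "bilin_ext ?g v w = JP u v w - RP u v w" for v w
          by (simp add: JP_def RP_def bilin_ext_def lin_ext_fun_diff)
        have "bilin_ext ?g ?A y \<in> pvs.span (M_filtration k)"
        proof (rule bilin_ext_span[of ?A "{?A}" y "M_filtration k"])
          fix a' b' assume a': "a' \<in> {?A}" and b': "b' \<in> (M_filtration k :: ('s tree \<Rightarrow>\<^sub>0 'k) set)"
          obtain v cv where *: "b' = M_colored v cv" "length cv = size v" "letters v \<le> k"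
            using b' unfolding M_filtration_def by blast
          then have "bilin_ext ?g a' b' = (\<Sum>w\<in>spine_inserts a v. M_colored w (c1 @ u # cv))
              - M_colored (over a v) (c1 @ u # cv)"
            using a' by (simp add: eq JP_M_colored M_colored_over len)
          also have "\<dots> = (\<Sum>w\<in>spine_inserts a v - {over a v}. M_colored w (c1 @ u # cv))"
            by (simp add: sum_diff1 finite_spine_inserts over_in_spine_inserts)
          also have "\<dots> \<in> pvs.span (M_filtration k)"
          proof (rule pvs.span_sum, rule pvs.span_base, rule M_filtrationI)
            fix w assume w: "w \<in> spine_inserts a v - {over a v}"
            then have "tamari_le w (Node a () v)" by (simp add: spine_inserts_le)
            from tamari_size[OF this] show "length (c1 @ u # cv) = size w" using * len by simp
            show "letters w \<le> k" using letters_spine_inserts[of w a v] w ab * by simp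
          qed
          finally show "bilin_ext ?g a' b' \<in> pvs.span (M_filtration k)" .
        qed (simp_all add: yF pvs.span_base)
        then show ?thesis by (auto simp: eq intro: F_W)
      qed
      have A: "?A \<in> KI sb" by (intro M_colored_irreducible_KI ab len)
      have "x = RP s ?A ?B" using x cs_eq ab len by (simp add: M_colored_over)
      \<comment> \<open>Telescoping: on \<open>y\<close> the over product along \<open>s\<close> is
        exchanged for the join, the color becomes \<open>sb\<close>, and the join is exchanged
        back.\<close>
      also have "\<dots> = RP sb ?A ?B + (RP s ?A d - RP sb ?A d) + (JP s ?A y - JP sb ?A y)
          - (JP s ?A y - RP s ?A y) + (JP sb ?A y - RP sb ?A y)"
        by (simp add: B_eq RP_def bilin_ext_add_right)
      also have "\<dots> \<in> ?W"
      proof -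
        have 1: "RP sb ?A ?B \<in> ?W"
          using ab b len by (intro pvs.span_base UnI2 decomposablesI) auto
        have 2: "RP s ?A d - RP sb ?A d \<in> ?W" by (intro pvs.span_diff RPd)
        have 3: "JP s ?A y - JP sb ?A y \<in> ?W" by (intro KI_W JP_diff_KI A y)
        show ?thesis
          by (rule pvs.span_add[OF pvs.span_diff[OF pvs.span_add[OF pvs.span_add[OF 1 2] 3] JR] JR])
      qed
      finally show ?thesis .
    qed
  qed
qed

lemma basis_in_span_M:
  "basis t \<in> pvs.span {M_colored u cs | u cs. length cs = size u}"
proof -
  have "colored (map_tree (\<lambda>_. ()) t) (inorder t) = t"
    by (induction t) (auto simp: nth_append)
  then have "basis t = (\<Sum>u\<in>down (map_tree (\<lambda>_. ()) t). M_colored u (inorder t))"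
    by (simp add: sum_M_colored)
  also have "\<dots> \<in> pvs.span {M_colored u cs | u cs. length cs = size u}"
  proof (intro pvs.span_sum pvs.span_base CollectI exI conjI)
    fix u assume "u \<in> down (map_tree (\<lambda>_. ()) t)"
    then have "tamari_le u (map_tree (\<lambda>_. ()) t)" by simp
    from tamari_size[OF this] show "length (inorder t) = size u" by simp
  qed simp
  finally show ?thesis .
qed

lemma KI_eq: "KI sb = {x :: 's tree \<Rightarrow>\<^sub>0 'k::field. rcoprod x = 0}"
proof (intro equalityI subsetI)
  fix x :: "'s tree \<Rightarrow>\<^sub>0 'k"
  assume "x \<in> {x. rcoprod x = 0}"
  then have x: "lin_ext (prim_part sb) x = x" by (simp add: prim_part_primitive)
  let ?M = "{M_colored u cs | u cs. length cs = size u} :: ('s tree \<Rightarrow>\<^sub>0 'k) set"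
  have "lin_ext basis x \<in> pvs.span ?M"
    by (rule lin_ext_in_subspace[OF pvs.subspace_span]) (rule basis_in_span_M)
  then have "x \<in> pvs.span ?M" by (simp add: lin_ext_basis_id)
  then have "lin_ext (prim_part sb) x \<in> KI sb"
  proof (rule lin_ext_span[OF _ subspace_KI])
    fix a assume "a \<in> ?M"
    then obtain u cs where "a = M_colored u cs" "length cs = size u" by blast
    then have "a \<in> M_filtration (letters u)" by (auto intro: M_filtrationI)
    then have "a \<in> pvs.span (I_all sb \<union> decomposables sb (letters u))"
      by (rule subsetD[OF M_filtration_subset])
    then obtain y d where a: "a = y + d" and y: "y \<in> KI sb"
        and d: "d \<in> pvs.span (decomposables sb (letters u))"
      unfolding pvs.span_Un KI_eq_span by auto
    \<comment> \<open>The projection kills the products in \<open>d\<close> and fixes the primitive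
      \<open>y\<close>.\<close>
    have "lin_ext (prim_part sb) d \<in> {0}"
      using d by (rule lin_ext_span) (auto simp: decomposables_def prim_part_RP)
    then show "lin_ext (prim_part sb) a \<in> KI sb"
      using y by (simp add: a prim_part_primitive rcoprod_KI)
  qed
  then show "x \<in> KI sb" by (simp add: x)
qed (simp add: rcoprod_KI)

theorem theorem3p12:
  fixes sb :: 's
  shows "(primitives :: ('s tree option \<Rightarrow>\<^sub>0 'k::field) set) = incl ` KI sb
    \<and> (\<exists>f :: ('s tree option \<Rightarrow>\<^sub>0 'k) \<Rightarrow> ('s tree list \<Rightarrow>\<^sub>0 'k).
         coalgebra_iso_onto coprod counit deconcat tensor_counit (tensor_space (KI sb)) f)"
  unfolding KI_eq by (intro conjI exI[of _ "to_words sb"] primitives_eq coalgebra_iso_to_words)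

end
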